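(* Fix $d_1>4$ and $d_0\ge1$, and let $d=d_0+d_1$. For each $\delta>0$ there exists $\beta_0=\beta_0(d_1,d_0,\delta)>0$ such that for all $\beta\le\beta_0$ and every random walk in a partially random environment on $\mathbb{Z}^d$ whose single-site environment law $\mu$ satisfies (1)–(3) of the context with parameters $\delta$ and $\beta$, there exists $\theta$ such that, as $n\to\infty$: (a) $\mathbb{E}_\beta[\omega_n]=\theta n\,\Big[1+O\Big(\dfrac{\log n}{n^{1\wedge\frac{d_1-4}{2}}}\Big)\Big]$; (b) $\dfrac{\omega_n}{n}\to\theta$ in probability under the annealed law $\mathbb{Q}_\beta$.
   Context: Random walk in a partially random environment (RWpRE). Let $d=d_0+d_1$. $U_d$ is the set of the $2d$ unit vectors $\pm e_i$ of $\mathbb{Z}^d$, $U_{d_0}\subset U_d$ the subset $\{\pm e_1,\dots,\pm e_{d_0}\}$, and $\mathcal{P}(U_d)$ the set of probability measures $W=\{W(u)\}_{u\in U_d}$ on $U_d$. Let $\mu$ be a probability measure on $\mathcal{P}(U_d)$, with expectation $E_\mu$, such that for given $\delta>0$ and $\beta<1$: (1) $\mu\big(\sum_{u\in U_{d_0}}W(u)\le1-\delta\big)=1$; (2) for each $v\in U_d\setminus U_{d_0}$, $\mu\big(W(v)=\frac{1-\sum_{u\in U_{d_0}}W(u)}{2d_1}\big)=1$; (3) for each $u\in U_d$, $\mu\big(|W(u)-E_\mu[W(u)]|<\beta\big)=1$. Let $\nu$ be the product measure on $\mathcal{P}(U_d)^{\mathbb{Z}^d}$ under which $\{W_x\}_{x\in\mathbb{Z}^d}$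 are i.i.d. with law $\mu$. Given the environment $W$, the walk $\{X_n\}$ is the Markov chain with $P_W(X_0=0)=1$ and $P_W(X_{n+1}=X_n+u\mid X_0,\dots,X_n)=W_{X_n}(u)$. The annealed law is $\mathbb{Q}_\beta(\vec\omega_n=\vec{x}_n)=\int P_W(\vec{X}_n=\vec{x}_n)\,d\nu$ for every path $\vec{x}_n=(x_0,\dots,x_n)$; $\mathbb{E}_\beta$ denotes expectation under $\mathbb{Q}_\beta$; $a\wedge b=\min(a,b)$. For a vector $v$, $v_n=vn[1+O(\epsilon_n)]$ means $|v_n-vn|=O(n\epsilon_n)$ as $n\to\infty$. *)

theory Defs
  imports "HOL-Probability.Probability" "HOL-Library.Landau_Symbols"
begin

text \<open>
  The lattice is \<^typ>\<open>int ^ 'n\<close>. For a walk in a partially random environment the index type is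
  a sum \<^typ>\<open>'a + 'b\<close> with \<open>CARD('a) = d\<^sub>0\<close> and \<open>CARD('b) = d\<^sub>1\<close>: the coordinates
  \<open>Inl i\<close> play the role of \<open>1, \<dots>, d\<^sub>0\<close>, the coordinates \<open>Inr j\<close> that of
  \<open>d\<^sub>0 + 1, \<dots>, d\<^sub>0 + d\<^sub>1\<close>.
\<close>

definition unit_steps :: "(int ^ 'n::finite) set" where
  "unit_steps = {axis i s | i s. s \<in> {1, -1}}"

definition unit_steps_left :: "(int ^ ('a::finite + 'b::finite)) set" where
  "unit_steps_left = {axis (Inl i) s | i s. s \<in> {1, -1}}"

text \<open>
  \<^term>\<open>prob_algebra\<close> is the measurable space of all probability measures, with the
  \<open>\<sigma>\<close>-algebra generated by the evaluation maps; over the finite set of unit steps this is the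
  simplex with its Borel \<open>\<sigma>\<close>-algebra. The number \<open>W(u)\<close> is \<^term>\<open>measure W {u}\<close>.
\<close>

definition step_laws :: "(int ^ 'n::finite) measure measure" where
  "step_laws = prob_algebra (count_space unit_steps)"

definition path_space :: "(nat \<Rightarrow> int ^ 'n::finite) measure" where
  "path_space = (\<Pi>\<^sub>M k\<in>UNIV. count_space UNIV)"

subsection \<open>The walk in a fixed environment\<close>

text \<open>The conditional law of \<open>X\<^sub>n\<close> given \<open>X\<^sub>0, \<dots>, X\<^sub>n\<^sub>-\<^sub>1\<close>.\<close>

definition walk_kernel ::
  "(int ^ 'n::finite \<Rightarrow> (int ^ 'n) measure) \<Rightarrow> nat \<Rightarrow> (nat \<Rightarrow> int ^ 'n) \<Rightarrow> (int ^ 'n) measure" where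
  "walk_kernel W n x = (case n of
      0 \<Rightarrow> return (count_space UNIV) 0
    | Suc m \<Rightarrow> distr (W (x m)) (count_space UNIV) (\<lambda>u. x m + u))"

text \<open>
  The law on path space obtained from these kernels by the Ionescu-Tulcea theorem. It is identified by
  its values on cylinders in \<open>measure_quenched_law_cylinder\<close> and \<open>quenched_law_start\<close> below.
\<close>

definition quenched_law ::
  "(int ^ 'n::finite \<Rightarrow> (int ^ 'n) measure) \<Rightarrow> (nat \<Rightarrow> int ^ 'n) measure" where
  "quenched_law W =
     projective_family.lim UNIV (Ionescu_Tulcea.CI (walk_kernel W) (\<lambda>_. count_space UNIV))
       (\<lambda>_. count_space UNIV)"

subsection \<open>Environment and annealed law\<close>

definition environment_law ::
  "(int ^ 'n::finite) measure measure \<Rightarrow> (int ^ 'n \<Rightarrow> (int ^ 'n) measure) measure" where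
  "environment_law \<mu> = (\<Pi>\<^sub>M x\<in>UNIV. \<mu>)"

text \<open>
  The mixture \<open>\<integral> P\<^sub>W(\<cdot>) d\<nu>(W)\<close>; see \<open>measure_annealed_law_cylinder\<close> below.
\<close>

definition annealed_law ::
  "(int ^ 'n::finite) measure measure \<Rightarrow> (nat \<Rightarrow> int ^ 'n) measure" where
  "annealed_law \<mu> = environment_law \<mu> \<bind> quenched_law"

definition partially_random ::
  "real \<Rightarrow> real \<Rightarrow> (int ^ ('a::finite + 'b::finite)) measure measure \<Rightarrow> bool" where
  "partially_random \<delta> \<beta> \<mu> \<longleftrightarrow>
     prob_space \<mu> \<and> sets \<mu> = sets step_laws \<and> \<delta> > 0 \<and> \<beta> < 1 \<and>
     \<P>(W in \<mu>. (\<Sum>u\<in>unit_steps_left. measure W {u}) \<le> 1 - \<delta>) = 1 \<and>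
     (\<forall>v\<in>unit_steps - unit_steps_left.
        \<P>(W in \<mu>. measure W {v} =
          (1 - (\<Sum>u\<in>unit_steps_left. measure W {u})) / (2 * real CARD('b))) = 1) \<and>
     (\<forall>u\<in>unit_steps.
        \<P>(W in \<mu>. \<bar>measure W {u} - (\<integral>V. measure V {u} \<partial>\<mu>)\<bar> < \<beta>) = 1)"

definition to_real_vec :: "int ^ 'n::finite \<Rightarrow> real ^ 'n" where
  "to_real_vec x = (\<chi> i. real_of_int (x $ i))"

subsection \<open>The laws on cylinders\<close>

definition cylinder :: "nat \<Rightarrow> (nat \<Rightarrow> 'c) \<Rightarrow> (nat \<Rightarrow> 'c) set" where
  "cylinder n x = {\<omega>. \<forall>k\<le>n. \<omega> k = x k}"

context
  fixes W :: "int ^ 'n::finite \<Rightarrow> (int ^ 'n) measure"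
  assumes W: "\<And>x. W x \<in> space step_laws"
begin

lemma step_law_prob_space: "prob_space (W x)"
  and step_law_sets: "sets (W x) = Pow unit_steps"
  using W[of x] by (auto simp: step_laws_def space_prob_algebra)

lemma step_law_space: "space (W x) = unit_steps"
  using step_law_sets sets_eq_imp_space_eq[of "W x" "count_space unit_steps"] by simp

lemma walk_kernel_in_prob_algebra: "walk_kernel W n x \<in> space (prob_algebra (count_space UNIV))"
proof -
  have "W y \<in> space (prob_algebra (count_space unit_steps))" for y
    using W by (simp add: step_laws_def)
  moreover have "(\<lambda>M. distr M (count_space UNIV) (\<lambda>u. y + u)) \<in>
      prob_algebra (count_space unit_steps) \<rightarrow>\<^sub>M prob_algebra (count_space UNIV)"
    for y :: "int ^ 'n"
    by (rule measurable_distr_prob_space) simp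
  ultimately have "distr (W y) (count_space UNIV) (\<lambda>u. y + u) \<in>
      space (prob_algebra (count_space UNIV))" for y
    by (rule measurable_space[rotated])
  then show ?thesis
    by (auto simp: walk_kernel_def space_prob_algebra prob_space_return split: nat.split)
qed

lemma Ionescu_Tulcea_walk: "Ionescu_Tulcea (walk_kernel W) (\<lambda>_. count_space UNIV)"
proof (rule Ionescu_Tulcea.intro)
  fix i
  have in_sub: "walk_kernel W n x \<in> space (subprob_algebra (count_space UNIV))" for n x
    using walk_kernel_in_prob_algebra[of n x]
    by (auto simp: space_prob_algebra space_subprob_algebra prob_space_imp_subprob_space)
  show "walk_kernel W i \<in>
      (\<Pi>\<^sub>M i\<in>{0..<i}. count_space UNIV) \<rightarrow>\<^sub>M subprob_algebra (count_space UNIV)"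
  proof (cases i)
    case 0
    then show ?thesis using in_sub[of 0 undefined]
      by (simp add: walk_kernel_def[abs_def])
  next
    case (Suc m)
    have "(\<lambda>y. walk_kernel W (Suc m) (\<lambda>_. y)) \<in>
        count_space UNIV \<rightarrow>\<^sub>M subprob_algebra (count_space UNIV)"
      using in_sub by (auto simp: measurable_def)
    moreover have "(\<lambda>x. x m) \<in> (\<Pi>\<^sub>M i\<in>{0..<i}. count_space UNIV) \<rightarrow>\<^sub>M count_space UNIV"
      using Suc by (intro measurable_component_singleton) auto
    ultimately have "(\<lambda>x. walk_kernel W (Suc m) (\<lambda>_. x m)) \<in>
        (\<Pi>\<^sub>M i\<in>{0..<i}. count_space UNIV) \<rightarrow>\<^sub>M subprob_algebra (count_space UNIV)"
      by (rule measurable_compose[rotated])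
    then show ?thesis
      using Suc by (simp add: walk_kernel_def[abs_def])
  qed
next
  show "prob_space (walk_kernel W i x)" for i x
    using walk_kernel_in_prob_algebra[of i x] by (simp add: space_prob_algebra)
qed

interpretation IT: Ionescu_Tulcea "walk_kernel W" "\<lambda>_. count_space UNIV"
  by (rule Ionescu_Tulcea_walk)

lemma sets_quenched_law: "sets (quenched_law W) = sets path_space"
  by (simp add: quenched_law_def path_space_def)

lemma space_quenched_law: "space (quenched_law W) = UNIV"
  by (simp add: quenched_law_def space_PiM)

lemma prob_space_quenched_law: "prob_space (quenched_law W)"
proof
  have "emeasure IT.PF.lim (IT.PF.emb UNIV {} {\<lambda>_. undefined}) = emeasure (IT.CI {}) {\<lambda>_. undefined}"
    by (rule IT.lim) (auto simp: sets_PiM_empty)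
  also have "\<dots> = emeasure (IT.CI {}) (space (IT.CI {}))"
    by (simp add: IT.CI_def space_PiM_empty)
  also have "\<dots> = 1"
    by (rule prob_space.emeasure_space_1[OF IT.PF.prob_space_P]) simp_all
  also have "IT.PF.emb UNIV {} {\<lambda>_. undefined} = (UNIV :: (nat \<Rightarrow> int ^ 'n) set)"
    by (auto simp: prod_emb_def)
  finally show "emeasure (quenched_law W) (space (quenched_law W)) = 1"
    by (simp add: quenched_law_def space_PiM)
qed

lemma point_in_sets_PiM:
  fixes x :: "nat \<Rightarrow> int ^ 'n"
  shows "{restrict x {0..<n}} \<in> sets (\<Pi>\<^sub>M i\<in>{0..<n}. count_space UNIV)"
proof -
  have "{restrict x {0..<n}} = (\<Pi>\<^sub>E i\<in>{0..<n}. {x i})"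
    by (auto simp: PiE_iff extensional_def fun_eq_iff)
  then show ?thesis by (simp only:) (intro sets_PiM_I_finite, auto)
qed

lemma emeasure_C_Suc:
  "emeasure (IT.C 0 (Suc n) (\<lambda>_. undefined)) {restrict x {0..<Suc n}} =
   emeasure (IT.C 0 n (\<lambda>_. undefined)) {restrict x {0..<n}} * emeasure (walk_kernel W n x) {x n}"
proof -
  let ?u = "\<lambda>_. undefined :: int ^ 'n"
  have u: "?u \<in> space (\<Pi>\<^sub>M i\<in>{0..<0::nat}. count_space UNIV)"
    by (simp add: space_PiM)
  have kernel: "walk_kernel W n (restrict x {0..<n}) = walk_kernel W n x"
    by (auto simp: walk_kernel_def split: nat.split)
  have "emeasure (IT.C 0 (Suc n) ?u) {restrict x {0..<Suc n}} =
      (\<integral>\<^sup>+\<omega>. emeasure (IT.eP n \<omega>) {restrict x {0..<Suc n}} \<partial>IT.C 0 n ?u)"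
    using emeasure_bind[of "IT.C 0 n ?u" "IT.eP n" "(\<Pi>\<^sub>M i\<in>{0..<Suc n}. count_space UNIV)"
        "{restrict x {0..<Suc n}}"] point_in_sets_PiM[of x "Suc n"] IT.measurable_eP[of n]
      IT.space_C[OF u, of n] IT.sets_C[OF u, of n] prob_space.not_empty[OF IT.prob_space_C[OF u, of n]]
    by (simp cong: measurable_cong_sets)
  also have "\<dots> = (\<integral>\<^sup>+\<omega>. emeasure (walk_kernel W n x) {x n} *
      indicator {restrict x {0..<n}} \<omega> \<partial>IT.C 0 n ?u)"
  proof (rule nn_integral_cong)
    fix \<omega> assume "\<omega> \<in> space (IT.C 0 n ?u)"
    then have \<omega>: "\<omega> \<in> space (\<Pi>\<^sub>M i\<in>{0..<n}. count_space UNIV)"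
      using IT.space_C[OF u, of n] by simp
    have ext: "\<omega> \<in> extensional {0..<n}"
      using \<omega> by (simp add: space_PiM PiE_def)
    have vimg: "(\<lambda>y. fun_upd \<omega> n y) -` {restrict x {0..<Suc n}} \<inter> UNIV =
        (if \<omega> = restrict x {0..<n} then {x n} else {})"
    proof -
      have "fun_upd \<omega> n y = restrict x {0..<Suc n} \<longleftrightarrow> \<omega> = restrict x {0..<n} \<and> y = x n" for y
        using ext unfolding fun_eq_iff extensional_def restrict_def
        by (auto simp: less_Suc_eq split: if_splits)
      then show ?thesis by auto
    qed
    show "emeasure (IT.eP n \<omega>) {restrict x {0..<Suc n}} =
        emeasure (walk_kernel W n x) {x n} * indicator {restrict x {0..<n}} \<omega>"
      by (subst IT.emeasure_eP[OF \<omega> point_in_sets_PiM]) (use vimg kernel in auto)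
  qed
  also have "\<dots> = emeasure (walk_kernel W n x) {x n} *
      emeasure (IT.C 0 n ?u) {restrict x {0..<n}}"
    using point_in_sets_PiM[of x n] IT.sets_C[OF u, of n]
    by (subst nn_integral_cmult_indicator) auto
  finally show ?thesis by (simp add: mult.commute)
qed

lemma emeasure_cylinder_eq_C:
  "emeasure (quenched_law W) (cylinder n x) =
   emeasure (IT.C 0 (Suc n) (\<lambda>_. undefined)) {restrict x {0..<Suc n}}"
proof -
  have emb: "cylinder n x = IT.PF.emb UNIV {0..<Suc n} {restrict x {0..<Suc n}}"
    by (auto simp: cylinder_def prod_emb_def fun_eq_iff restrict_def less_Suc_eq_le) metis
  have "emeasure (quenched_law W) (cylinder n x) =
      emeasure (IT.CI {0..<Suc n}) {restrict x {0..<Suc n}}"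
    unfolding emb quenched_law_def by (rule IT.lim) (use point_in_sets_PiM in auto)
  also have "\<dots> = emeasure (IT.C 0 (Suc n) (\<lambda>_. undefined))
      (IT.PF.emb {0..<Suc n} {0..<Suc n} {restrict x {0..<Suc n}})"
    by (rule IT.emeasure_CI) (use point_in_sets_PiM in auto)
  also have "IT.PF.emb {0..<Suc n} {0..<Suc n} {restrict x {0..<Suc n}} = {restrict x {0..<Suc n}}"
    by (intro prod_emb_id) (auto simp: PiE_def)
  finally show ?thesis .
qed

lemma emeasure_walk_kernel_Suc:
  "emeasure (walk_kernel W (Suc n) x) {y} = emeasure (W (x n)) {y - x n}"
proof -
  have "emeasure (walk_kernel W (Suc n) x) {y} =
      emeasure (W (x n)) ((\<lambda>u. x n + u) -` {y} \<inter> unit_steps)"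
    unfolding walk_kernel_def
    by (simp, subst emeasure_distr)
      (auto simp: step_law_space measurable_def step_law_sets)
  also have "(\<lambda>u. x n + u) -` {y} \<inter> unit_steps = {y - x n} \<inter> unit_steps"
    by auto
  also have "emeasure (W (x n)) ({y - x n} \<inter> unit_steps) = emeasure (W (x n)) {y - x n}"
    by (cases "y - x n \<in> unit_steps") (auto simp: emeasure_notin_sets step_law_sets)
  finally show ?thesis .
qed

lemma emeasure_quenched_law_cylinder_0:
  "emeasure (quenched_law W) (cylinder 0 x) = indicator {0} (x 0)"
proof -
  have "{\<lambda>_. undefined} \<in> sets (\<Pi>\<^sub>M i\<in>({0..<0}::nat set). count_space (UNIV :: (int ^ 'n) set))"
    by (simp add: PiM_empty)
  then show ?thesis
    unfolding emeasure_cylinder_eq_C emeasure_C_Suc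
    by (auto simp: walk_kernel_def restrict_def split: split_indicator)
qed

lemma emeasure_quenched_law_cylinder_Suc:
  "emeasure (quenched_law W) (cylinder (Suc n) x) =
   emeasure (quenched_law W) (cylinder n x) * emeasure (W (x n)) {x (Suc n) - x n}"
  unfolding emeasure_cylinder_eq_C emeasure_C_Suc[of "Suc n"] emeasure_walk_kernel_Suc ..

text \<open>\<open>P\<^sub>W(X\<^sub>0 = 0) = 1\<close> and the Markov property.\<close>

lemma quenched_law_start: "measure (quenched_law W) {\<omega>. \<omega> 0 = 0} = 1"
  using emeasure_quenched_law_cylinder_0[of "\<lambda>_. 0"] by (simp add: measure_def cylinder_def)

lemma quenched_law_step:
  "measure (quenched_law W) (cylinder (Suc n) x) =
   measure (quenched_law W) (cylinder n x) * measure (W (x n)) {x (Suc n) - x n}"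
  by (simp add: measure_def emeasure_quenched_law_cylinder_Suc enn2real_mult)

lemma measure_quenched_law_cylinder:
  "measure (quenched_law W) (cylinder n x) =
   (if x 0 = 0 then \<Prod>k<n. measure (W (x k)) {x (Suc k) - x k} else 0)"
proof (induction n)
  case 0
  show ?case using emeasure_quenched_law_cylinder_0[of x] by (simp add: measure_def)
next
  case (Suc n)
  then show ?case by (simp add: quenched_law_step)
qed

end

lemma sets_path_space:
  "sets (path_space :: (nat \<Rightarrow> int ^ 'n::finite) measure) =
   sigma_sets UNIV (insert {} (range (\<lambda>(n, x). cylinder n x)))" (is "_ = sigma_sets UNIV ?G")
proof (intro antisym)
  have cyl: "cylinder n x \<in> sets path_space" for n and x :: "nat \<Rightarrow> int ^ 'n"
  proof -
    have "cylinder n x = {\<omega> \<in> space path_space. \<forall>k\<le>n. \<omega> k = x k}"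
      by (auto simp: cylinder_def path_space_def space_PiM)
    also have "\<dots> \<in> sets path_space"
      unfolding path_space_def by measurable
    finally show ?thesis .
  qed
  have "UNIV = space (path_space :: (nat \<Rightarrow> int ^ 'n) measure)"
    by (simp add: path_space_def space_PiM)
  moreover have "?G \<subseteq> sets path_space"
    using cyl by auto
  ultimately show "sigma_sets UNIV ?G \<subseteq> sets (path_space :: (nat \<Rightarrow> int ^ 'n) measure)"
    using sets.sigma_sets_subset[of ?G "path_space :: (nat \<Rightarrow> int ^ 'n) measure"] by metis
next
  have evt: "{\<omega>. \<omega> i \<in> A} \<in> sigma_sets UNIV ?G" for i and A :: "(int ^ 'n) set"
  proof -
    let ?L = "{xs :: (int ^ 'n) list. length xs = Suc i \<and> xs ! i \<in> A}"
    have "{\<omega>. \<omega> i \<in> A} = (\<Union>xs\<in>?L. cylinder i (\<lambda>k. xs ! k))"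
    proof (intro equalityI subsetI)
      fix \<omega> assume "\<omega> \<in> {\<omega>. \<omega> i \<in> A}"
      then show "\<omega> \<in> (\<Union>xs\<in>?L. cylinder i (\<lambda>k. xs ! k))"
        by (intro UN_I[of "map \<omega> [0..<Suc i]"]) (auto simp: cylinder_def nth_append simp del: upt_Suc)
    qed (auto simp: cylinder_def)
    also have "\<dots> \<in> sigma_sets UNIV ?G"
    proof -
      interpret sigma_algebra UNIV "sigma_sets UNIV ?G"
        by (rule sigma_algebra_sigma_sets) auto
      show ?thesis
        by (intro countable_UN'') (auto intro!: sigma_sets.Basic)
    qed
    finally show ?thesis .
  qed
  show "sets (path_space :: (nat \<Rightarrow> int ^ 'n) measure) \<subseteq> sigma_sets UNIV ?G"
    unfolding path_space_def sets_PiM_single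
    by (auto intro!: sigma_sets_mono simp: evt)
qed

lemma measurable_quenched_law:
  "quenched_law \<in> (\<Pi>\<^sub>M x\<in>UNIV. step_laws) \<rightarrow>\<^sub>M
     prob_algebra (path_space :: (nat \<Rightarrow> int ^ 'n::finite) measure)"
proof (rule measurable_prob_algebraI)
  have env: "W x \<in> space step_laws" if "W \<in> space (\<Pi>\<^sub>M x\<in>UNIV. step_laws)"
    for W :: "int ^ 'n \<Rightarrow> (int ^ 'n) measure" and x
    using that by (auto simp: space_PiM)
  show "prob_space (quenched_law W)" if "W \<in> space (\<Pi>\<^sub>M x\<in>UNIV. step_laws)"
    for W :: "int ^ 'n \<Rightarrow> (int ^ 'n) measure"
    using prob_space_quenched_law[OF env[OF that]] .
  have step: "(\<lambda>W. emeasure (W y) {u}) \<in> borel_measurable (\<Pi>\<^sub>M x\<in>UNIV. step_laws)"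
    for y u :: "int ^ 'n"
  proof (cases "u \<in> unit_steps")
    case True
    then have "(\<lambda>M. emeasure M {u}) \<in> borel_measurable step_laws"
      unfolding step_laws_def prob_algebra_def
      by (intro measurable_restrict_space1 measurable_emeasure_subprob_algebra) auto
    then show ?thesis
      by (rule measurable_compose[rotated]) (rule measurable_component_singleton, simp)
  next
    case False
    have "emeasure (W y) {u} = 0" if "W \<in> space (\<Pi>\<^sub>M x\<in>UNIV. step_laws)"
      for W :: "int ^ 'n \<Rightarrow> (int ^ 'n) measure"
      using False step_law_sets[of W y, OF env[OF that]] by (intro emeasure_notin_sets) auto
    then show ?thesis by (simp cong: measurable_cong)
  qed
  have cyl: "(\<lambda>W. emeasure (quenched_law W) (cylinder n x)) \<in>
      borel_measurable (\<Pi>\<^sub>M x\<in>UNIV. step_laws)" for n and x :: "nat \<Rightarrow> int ^ 'n"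
  proof (induction n)
    case 0
    then show ?case
      by (subst measurable_cong[OF emeasure_quenched_law_cylinder_0[OF env]]) auto
  next
    case (Suc n)
    then show ?case
      by (subst measurable_cong[OF emeasure_quenched_law_cylinder_Suc[OF env]]) (auto intro!: borel_measurable_times_ennreal step)
  qed
  let ?G = "insert {} (range (\<lambda>(n, x). cylinder n x)) :: (nat \<Rightarrow> int ^ 'n) set set"
  show "quenched_law \<in> (\<Pi>\<^sub>M x\<in>UNIV. step_laws) \<rightarrow>\<^sub>M
      subprob_algebra (path_space :: (nat \<Rightarrow> int ^ 'n) measure)"
  proof (rule measurable_subprob_algebra_generated[OF sets_path_space])
    have *: "cylinder n x \<inter> cylinder m y \<in> ?G" for n m and x y :: "nat \<Rightarrow> int ^ 'n"
    proof (cases "\<exists>\<omega>. \<omega> \<in> cylinder n x \<inter> cylinder m y")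
      case True
      then obtain \<omega> where "\<omega> \<in> cylinder n x \<inter> cylinder m y" by blast
      then have "cylinder n x \<inter> cylinder m y = cylinder (max n m) \<omega>"
        by (auto simp: cylinder_def le_max_iff_disj)
      then show ?thesis by auto
    qed auto
    show "Int_stable ?G"
    proof (rule Int_stableI)
      fix A B :: "(nat \<Rightarrow> int ^ 'n) set"
      assume "A \<in> ?G" "B \<in> ?G"
      then consider "A = {} \<or> B = {}" | n x m y where "A = cylinder n x" "B = cylinder m y"
        by auto
      then show "A \<inter> B \<in> ?G"
        using * by cases (auto simp only: Int_empty_left Int_empty_right insertI1)
    qed
    show "?G \<subseteq> Pow UNIV" by simp
    fix W :: "int ^ 'n \<Rightarrow> (int ^ 'n) measure"
    assume W: "W \<in> space (\<Pi>\<^sub>M x\<in>UNIV. step_laws)"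
    show "subprob_space (quenched_law W)"
      using prob_space_quenched_law[OF env[OF W]] by (rule prob_space_imp_subprob_space)
    show "sets (quenched_law W) = sets path_space"
      by (rule sets_quenched_law[OF env[OF W]])
  next
    show "(\<lambda>W. emeasure (quenched_law W) A) \<in> borel_measurable (\<Pi>\<^sub>M x\<in>UNIV. step_laws)"
      if "A \<in> ?G" for A
      using that cyl by auto
    have "emeasure (quenched_law W) UNIV = 1" if "W \<in> space (\<Pi>\<^sub>M x\<in>UNIV. step_laws)"
      for W :: "int ^ 'n \<Rightarrow> (int ^ 'n) measure"
      using prob_space.emeasure_space_1[OF prob_space_quenched_law[OF env[OF that]]]
        space_quenched_law[OF env[OF that]] by simp
    then show "(\<lambda>W. emeasure (quenched_law W) UNIV) \<in>
        borel_measurable (\<Pi>\<^sub>M x\<in>UNIV. step_laws :: (int ^ 'n) measure measure)"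
      by (subst measurable_cong[where g = "\<lambda>_. 1"]) auto
  qed
qed

context
  fixes \<mu> :: "(int ^ 'n::finite) measure measure"
  assumes prob: "prob_space \<mu>" and sets: "sets \<mu> = sets step_laws"
begin

lemma environment_law_in_prob_algebra:
  "environment_law \<mu> \<in> space (prob_algebra (\<Pi>\<^sub>M x\<in>UNIV. step_laws))"
  unfolding environment_law_def space_prob_algebra
  using prob sets by (auto intro!: prob_space_PiM sets_PiM_cong)

lemma annealed_law_in_prob_algebra: "annealed_law \<mu> \<in> space (prob_algebra path_space)"
  using prob_space_bind'[OF environment_law_in_prob_algebra measurable_quenched_law]
    sets_bind'[OF environment_law_in_prob_algebra measurable_quenched_law]
  by (simp add: annealed_law_def space_prob_algebra)

lemma measure_annealed_law:
  assumes "A \<in> sets path_space"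
  shows "measure (annealed_law \<mu>) A = (\<integral>W. measure (quenched_law W) A \<partial>environment_law \<mu>)"
proof -
  interpret env: prob_space "environment_law \<mu>"
    using environment_law_in_prob_algebra by (simp add: space_prob_algebra)
  have "quenched_law \<in> environment_law \<mu> \<rightarrow>\<^sub>M subprob_algebra path_space"
    using measurable_prob_algebraD[OF measurable_quenched_law] environment_law_in_prob_algebra
    by (simp add: space_prob_algebra cong: measurable_cong_sets)
  then show ?thesis
    unfolding annealed_law_def using assms by (rule env.measure_bind)
qed

lemma measure_annealed_law_cylinder:
  "measure (annealed_law \<mu>) (cylinder n x) =
   (\<integral>W. measure (quenched_law W) (cylinder n x) \<partial>environment_law \<mu>)"
  by (rule measure_annealed_law) (auto simp: sets_path_space intro!: sigma_sets.Basic)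

end

end

theory Submission
  imports Defs "HOL-Real_Asymp.Real_Asymp"
begin

text \<open>
  Averaging over the environment turns the walk into a walk with memory: given the path so far, the
  next step from \<open>z\<close> is \<open>u\<close> with probability \<open>E[W(u) \<Prod>W(v)] / E[\<Prod>W(v)]\<close>, where \<open>v\<close> runs through
  the earlier departures from \<open>z\<close> and \<open>E\<close> is the mean under \<open>\<mu>\<close>. The past therefore matters only at
  sites that have been visited before, and there it changes the probabilities by at most \<open>2\<beta>\<close>.

  Let \<open>v\<^sub>m\<close> be the mean of the step number \<open>m + 1\<close>, so that the mean position at time \<open>n\<close> is
  \<open>v\<^sub>0 + \<dots> + v\<^sub>n\<^sub>-\<^sub>1\<close>. After its first step the walk is a walk that starts afresh, except that it
  remembers its starting point. So \<open>v\<^sub>m\<^sub>+\<^sub>1 - v\<^sub>m\<close> is the effect of this memory, and more generally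
  one asks how much the mean of a later step changes when a piece \<open>g\<close> of the past is forgotten.
  By a Duhamel formula (\<open>forgetting_cost\<close>) one pays at the times \<open>j\<close> at which the walk stands on a
  site of \<open>g\<close>. Each payment is \<open>2\<beta>\<close> times a quantity of the same kind, in which the piece to be
  forgotten consists of the \<open>j + 1\<close> sites seen since. The effect of forgetting \<open>g\<close>, summed over all
  later steps, is thus bounded by a constant times the length of \<open>g\<close>, provided that \<open>\<beta>\<close> is small and
  the sums \<open>\<Sum>\<^sub>j (j + 1) P(X\<^sub>j = z)\<close> are bounded. With the weights \<open>min (m + 1) N\<close> on the steps, the
  recursion closes in the same way (\<open>weighted_memory_effect_le\<close>), the constant being a multiple of
  \<open>\<Gamma> N\<close>, a bound for \<open>\<Sum>\<^sub>j (j + 1) min (j + 1) N P(X\<^sub>j = z)\<close>. Since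
  \<open>\<Sum>\<^sub>k\<^sub><\<^sub>n |v\<^sub>k - \<theta>| \<le> \<Sum>\<^sub>m min (m + 1) n |v\<^sub>m\<^sub>+\<^sub>1 - v\<^sub>m|\<close>, this gives the existence of \<open>\<theta> = lim v\<^sub>m\<close> and
  the bound \<open>O(\<Gamma> n)\<close> for the error of the mean position.

  It remains to bound \<open>\<Gamma>\<close>, and here the last \<open>d\<^sub>1\<close> coordinates enter: whenever they move, they make
  a step of simple random walk, whatever the past. The times at which they move do depend on the
  past, which makes bounds for \<open>P(X\<^sub>j = z)\<close> at a fixed time \<open>j\<close> delicate, but sums over \<open>j\<close> only need
  a supersolution: a combination of the simple random walk kernels with coefficients that grow with
  the time and the number of moves (\<open>weighted_visits_le_potential\<close>). Since these kernels are
  \<open>O(k\<^bsup>- 2 - s\<^esup>)\<close> with \<open>s = min 1 ((d\<^sub>1 - 4) / 2)\<close>, one obtains \<open>\<Gamma> N = O(N\<^bsup>1 - s\<^esup> log N)\<close>.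

  For the law of large numbers the second moment of \<open>X\<^sub>n - n\<theta>\<close> is expanded in the same velocities.
  Now the past is that of the walk itself at time \<open>i \<le> n\<close>, and a bound proportional to its length
  would be too weak; but the site visited \<open>t\<close> steps ago contributes only \<open>O(\<Gamma> n / t)\<close> on average,
  so that the second moment is \<open>O(n \<Gamma> n log n)\<close>.
\<close>

section \<open>Heat kernel bounds for simple random walk\<close>

fun line_walk :: "nat \<Rightarrow> int \<Rightarrow> real" where
  "line_walk 0 x = of_bool (x = 0)"
| "line_walk (Suc m) x = (line_walk m (x - 1) + line_walk m (x + 1)) / 2"

text \<open>
  A walk on the line that stands at \<open>x\<close> after \<open>m\<close> steps has made \<open>(x + m) / 2\<close> steps upwards.
\<close>

lemma line_walk_eq_binomial:
  "line_walk m x = (if even (x + int m) \<and> 0 \<le> x + int m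
     then real (m choose nat ((x + int m) div 2)) / 2 ^ m else 0)"
proof (induction m arbitrary: x)
  case 0
  show ?case by (auto elim!: evenE)
next
  case (Suc m)
  show ?case
  proof (cases "even (x + int (Suc m)) \<and> 0 \<le> x + int (Suc m)")
    case True
    then obtain j where "x + int (Suc m) = 2 * j" unfolding dvd_def by blast
    with True obtain k where k: "x + int (Suc m) = 2 * int k"
      by (metis nonneg_int_cases zero_le_mult_iff zero_le_numeral not_numeral_le_zero)
    then have x: "x = 2 * int k - int (Suc m)" by simp
    show ?thesis
    proof (cases k)
      case 0
      then show ?thesis by (simp add: Suc.IH x)
    next
      case (Suc l)
      have "line_walk m (x - 1) = real (m choose l) / 2 ^ m"
        using Suc by (simp add: Suc.IH x)
      moreover have "line_walk m (x + 1) = real (m choose Suc l) / 2 ^ m"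
      proof -
        have e: "x + 1 + int m = 2 * int (Suc l)" using Suc by (simp add: x)
        show ?thesis unfolding Suc.IH e by (simp del: of_nat_Suc)
      qed
      moreover have "nat ((x + int (Suc m)) div 2) = Suc l"
        using Suc k by simp
      ultimately show ?thesis
        using True by (simp add: field_simps)
    qed
  next
    case False
    then have "\<not> (even (x + 1 + int m) \<and> 0 \<le> x + 1 + int m)"
      "\<not> (even (x - 1 + int m) \<and> 0 \<le> x - 1 + int m)"
      by (auto simp: algebra_simps)
    then have "line_walk m (x - 1) = 0" "line_walk m (x + 1) = 0"
      unfolding Suc.IH by (simp_all only: if_False)
    then show ?thesis using False by (simp only: if_False line_walk.simps) simp
  qed
qed

lemma line_walk_nonneg: "0 \<le> line_walk m x"
  by (induction m arbitrary: x) auto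

text \<open>
  For \<open>a\<^sub>n = (2n choose n) / 4\<^sup>n\<close> one has \<open>a\<^sub>n\<^sub>+\<^sub>1 = a\<^sub>n (2n + 1) / (2n + 2)\<close>, and therefore
  \<open>a\<^sub>n\<^sup>2 (2n + 1)\<close> decreases, because \<open>(2n + 1) (2n + 3) \<le> (2n + 2)\<^sup>2\<close>.
\<close>

lemma central_binomial_sqrt: "real ((2 * n) choose n) / 4 ^ n \<le> 1 / sqrt (real (2 * n + 1))"
proof -
  have step: "real ((2 * Suc n) choose Suc n) / 4 ^ Suc n =
      real ((2 * n) choose n) / 4 ^ n * (real (2 * n + 1) / real (2 * n + 2))" for n
  proof -
    have "Suc n * ((2 * Suc n) choose Suc n) = (2 * Suc n) * (Suc (2 * n) choose n)"
      using Suc_times_binomial_eq[of "Suc (2 * n)" n] by simp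
    then have 1: "(2 * Suc n) choose Suc n = 2 * (Suc (2 * n) choose n)"
      by (metis (no_types, lifting) Suc_neq_Zero mult.assoc mult.commute mult_left_cancel)
    have "Suc n * (Suc (2 * n) choose Suc n) = Suc (2 * n) * ((2 * n) choose n)"
      using Suc_times_binomial_eq[of "2 * n" n] by simp
    moreover have "Suc (2 * n) choose Suc n = Suc (2 * n) choose n"
      using binomial_symmetric[of n "Suc (2 * n)"] by simp
    ultimately have "real (Suc n) * real (Suc (2 * n) choose n) = real (Suc (2 * n)) * real ((2 * n) choose n)"
      by (metis of_nat_mult)
    then have "real (Suc (2 * n) choose n) =
        real ((2 * n) choose n) * (real (2 * n + 1) / real (n + 1))"
      by (simp add: field_simps)
    then have "real ((2 * Suc n) choose Suc n) =
        2 * (real ((2 * n) choose n) * (real (2 * n + 1) / real (n + 1)))"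
      unfolding 1 by simp
    then have "real ((2 * Suc n) choose Suc n) / 4 ^ Suc n =
        2 * (real ((2 * n) choose n) * (real (2 * n + 1) / real (n + 1))) / (4 * 4 ^ n)"
      by (simp only: power_Suc)
    also have "\<dots> = real ((2 * n) choose n) / 4 ^ n * (real (2 * n + 1) / (2 * real (n + 1)))"
      by (simp only: times_divide_eq_right times_divide_eq_left divide_divide_eq_left
          mult.assoc mult.commute mult.left_commute) (simp add: divide_simps)
    also have "2 * real (n + 1) = real (2 * n + 2)" by simp
    finally show ?thesis .
  qed
  have "(real ((2 * n) choose n) / 4 ^ n)\<^sup>2 * real (2 * n + 1) \<le> 1"
  proof (induction n)
    case 0
    show ?case by simp
  next
    case (Suc n)
    define a where "a = real ((2 * n) choose n) / 4 ^ n"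
    have "(real (2 * n + 1) / real (2 * n + 2))\<^sup>2 * real (2 * Suc n + 1) \<le> real (2 * n + 1)"
    proof -
      have "real (2 * n + 1) * (real (2 * n + 1) * real (2 * Suc n + 1)) \<le>
          real (2 * n + 1) * (real (2 * n + 2) * real (2 * n + 2))"
        by (intro mult_left_mono) (simp_all add: algebra_simps)
      then show ?thesis
        by (simp add: power_divide pos_divide_le_eq power2_eq_square mult.assoc)
    qed
    then have "a\<^sup>2 * ((real (2 * n + 1) / real (2 * n + 2))\<^sup>2 * real (2 * Suc n + 1)) \<le> a\<^sup>2 * real (2 * n + 1)"
      by (intro mult_left_mono) auto
    also have "\<dots> \<le> 1" using Suc by (simp add: a_def)
    finally show ?case unfolding step a_def by (simp only: power_mult_distrib mult.assoc)
  qed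
  then have "sqrt ((real ((2 * n) choose n) / 4 ^ n)\<^sup>2 * real (2 * n + 1)) \<le> 1"
    using real_sqrt_le_1_iff by blast
  then have "real ((2 * n) choose n) / 4 ^ n * sqrt (real (2 * n + 1)) \<le> 1"
    by (simp only: real_sqrt_mult real_sqrt_abs abs_of_nonneg divide_nonneg_nonneg of_nat_0_le_iff
        zero_le_power zero_le_numeral)
  then show ?thesis
    by (subst pos_le_divide_eq) (auto simp only: real_sqrt_gt_0_iff of_nat_0_less_iff)
qed

lemma line_walk_le: "line_walk m x \<le> 1 / sqrt (real (m + 1))"
proof -
  have "line_walk m x \<le> real (m choose (m div 2)) / 2 ^ m"
    unfolding line_walk_eq_binomial by (auto intro!: divide_right_mono binomial_maximum)
  also have "\<dots> \<le> 1 / sqrt (real (m + 1))"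
  proof (cases "even m")
    case True
    then obtain n where "m = 2 * n" by auto
    moreover have "(2::real) ^ (2 * n) = 4 ^ n" by (simp add: power_mult)
    ultimately show ?thesis using central_binomial_sqrt[of n] by simp
  next
    case False
    then obtain n where m: "m = 2 * n + 1" by (auto elim!: oddE)
    have "Suc n * ((2 * Suc n) choose Suc n) = (2 * Suc n) * (Suc (2 * n) choose n)"
      using Suc_times_binomial_eq[of "Suc (2 * n)" n] by simp
    then have "(2 * Suc n) choose Suc n = 2 * (Suc (2 * n) choose n)"
      by (metis (no_types, lifting) Suc_neq_Zero mult.assoc mult.commute mult_left_cancel)
    then have "real (m choose (m div 2)) / 2 ^ m = real ((2 * Suc n) choose Suc n) / 4 ^ Suc n"
    proof -
      have "(2::real) ^ (2 * n) = 4 ^ n" by (simp add: power_mult)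
      moreover have "m div 2 = n" using m by simp
      ultimately show ?thesis
        using \<open>(2 * Suc n) choose Suc n = 2 * (Suc (2 * n) choose n)\<close> by (simp add: m)
    qed
    also have "\<dots> \<le> 1 / sqrt (real (2 * Suc n + 1))" by (rule central_binomial_sqrt)
    also have "\<dots> \<le> 1 / sqrt (real (m + 1))"
      by (intro divide_left_mono) (auto simp: m)
    finally show ?thesis .
  qed
  finally show ?thesis .
qed

text \<open>
  The mean of \<open>F n\<close> when \<open>n j\<close> counts the steps in direction \<open>j\<close> among \<open>k\<close> steps with uniform
  independent directions. The recursion adds a step inside the argument of \<open>F\<close>, so that the
  recursion of the heat kernel below follows from linearity alone.
\<close>

fun occupation_mean :: "nat \<Rightarrow> (('b::finite \<Rightarrow> nat) \<Rightarrow> real) \<Rightarrow> real" where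
  "occupation_mean 0 F = F (\<lambda>_. 0)"
| "occupation_mean (Suc k) F =
     occupation_mean k (\<lambda>n. (\<Sum>j\<in>UNIV. F (n(j := Suc (n j)))) / real CARD('b))"

lemma occupation_mean_mono:
  "(\<And>n. F n \<le> G n) \<Longrightarrow> occupation_mean k F \<le> occupation_mean k G"
proof (induction k arbitrary: F G)
  case (Suc k)
  show ?case unfolding occupation_mean.simps
    by (rule Suc.IH) (auto intro!: divide_right_mono sum_mono Suc.prems)
qed simp

lemma occupation_mean_add:
  "occupation_mean k (\<lambda>n. F n + G n) = occupation_mean k F + occupation_mean k G"
  by (induction k arbitrary: F G) (simp_all add: sum.distrib add_divide_distrib)

lemma occupation_mean_zero: "occupation_mean k (\<lambda>n. 0) = 0"
  by (induction k) simp_all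

lemma occupation_mean_cmult:
  "occupation_mean k (\<lambda>n. c * F n) = c * occupation_mean k F"
  by (induction k arbitrary: F) (simp_all flip: sum_distrib_left times_divide_eq_right)

lemma occupation_mean_sum:
  "occupation_mean k (\<lambda>n. \<Sum>i\<in>I. F i n) = (\<Sum>i\<in>I. occupation_mean k (F i))"
  by (induction I rule: infinite_finite_induct)
    (simp_all add: occupation_mean_zero occupation_mean_add)

text \<open>
  Given how many steps are made in each direction, the coordinates of simple random walk are
  independent walks on the line.
\<close>

definition heat_kernel :: "nat \<Rightarrow> int ^ 'b::finite \<Rightarrow> real" where
  "heat_kernel k x = occupation_mean k (\<lambda>n. \<Prod>j\<in>UNIV. line_walk (n j) (x $ j))"

lemma heat_kernel_0: "heat_kernel 0 x = of_bool (x = 0)"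
  unfolding heat_kernel_def by (auto simp: vec_eq_iff)

lemma heat_kernel_nonneg: "0 \<le> heat_kernel k x"
  unfolding heat_kernel_def
  by (rule occupation_mean_mono[of "\<lambda>_. 0" _ k, unfolded occupation_mean_zero])
    (auto intro!: prod_nonneg line_walk_nonneg)

lemma heat_kernel_Suc:
  "heat_kernel (Suc k) (x :: int ^ 'b::finite) =
   (\<Sum>j\<in>UNIV. heat_kernel k (x + axis j 1) + heat_kernel k (x + axis j (- 1))) / (2 * real CARD('b))"
proof -
  have one: "(\<Prod>i\<in>UNIV. line_walk ((n(j := Suc (n j))) i) (x $ i)) =
      ((\<Prod>i\<in>UNIV. line_walk (n i) ((x + axis j 1) $ i)) +
       (\<Prod>i\<in>UNIV. line_walk (n i) ((x + axis j (- 1)) $ i))) / 2" for n :: "'b \<Rightarrow> nat" and j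
  proof -
    have split: "(\<Prod>i\<in>UNIV. g i) = g j * (\<Prod>i\<in>UNIV - {j}. g i)" for g :: "'b \<Rightarrow> real"
      by (rule prod.remove) auto
    have "(\<Prod>i\<in>UNIV - {j}. line_walk ((n(j := Suc (n j))) i) (x $ i)) =
        (\<Prod>i\<in>UNIV - {j}. line_walk (n i) (x $ i))"
      "(\<Prod>i\<in>UNIV - {j}. line_walk (n i) ((x + axis j s) $ i)) =
        (\<Prod>i\<in>UNIV - {j}. line_walk (n i) (x $ i))" for s
      by (rule prod.cong; simp add: axis_def)+
    then show ?thesis
      unfolding split by (simp add: algebra_simps add_divide_distrib)
  qed
  show ?thesis
    unfolding heat_kernel_def occupation_mean.simps one
    by (simp add: sum_divide_distrib flip: occupation_mean_add occupation_mean_sum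
        occupation_mean_cmult[where c = "1 / (2 * real CARD('b))", simplified])
qed

text \<open>
  On \<open>[X, X + 1]\<close> the function \<open>X powr (- \<sigma>)\<close> decreases at a rate of at least
  \<open>2 powr (- \<sigma> - 1)\<close> times its rate at \<open>X\<close>, because \<open>X + 1 \<le> 2 X\<close>. Hence a random increment, equal to \<open>1\<close> with probability \<open>p\<close>, may be
  replaced by the certain increment \<open>p * 2 powr (- \<sigma> - 1)\<close>.
\<close>

lemma powr_neg_shift_average:
  fixes p \<sigma> X :: real
  assumes p: "0 < p" "p \<le> 1" and \<sigma>: "0 < \<sigma>" and X: "1 \<le> X"
  shows "p * (X + 1) powr (- \<sigma>) + (1 - p) * X powr (- \<sigma>) \<le> (X + p * 2 powr (- \<sigma> - 1)) powr (- \<sigma>)"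
proof -
  define c where "c = p * 2 powr (- \<sigma> - 1)"
  have c: "0 < c" using p by (simp add: c_def)
  have tangent: "\<exists>z. Y < z \<and> z < Y + a \<and>
      (Y + a) powr (- \<sigma>) - Y powr (- \<sigma>) = a * (- \<sigma> * z powr (- \<sigma> - 1))"
    if "0 < Y" "0 < a" for Y a :: real
    using MVT2[of Y "Y + a" "\<lambda>z. z powr (- \<sigma>)" "\<lambda>z. - \<sigma> * z powr (- \<sigma> - 1)"] that
    by (force intro!: derivative_eq_intros)
  obtain z where z: "X < z" "z < X + c"
    "(X + c) powr (- \<sigma>) - X powr (- \<sigma>) = c * (- \<sigma> * z powr (- \<sigma> - 1))"
    using tangent[of X c] X c by auto
  obtain y where y: "X < y" "y < X + 1"
    "(X + 1) powr (- \<sigma>) - X powr (- \<sigma>) = 1 * (- \<sigma> * y powr (- \<sigma> - 1))"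
    using tangent[of X 1] X by auto
  have "c * z powr (- \<sigma> - 1) \<le> c * X powr (- \<sigma> - 1)"
    using z(1) X c \<sigma> by (intro mult_left_mono powr_mono2') auto
  also have "\<dots> = p * (2 * X) powr (- \<sigma> - 1)"
    using X by (simp add: c_def powr_mult)
  also have "\<dots> \<le> p * y powr (- \<sigma> - 1)"
    using y X p \<sigma> by (intro mult_left_mono powr_mono2') auto
  finally have "\<sigma> * (c * z powr (- \<sigma> - 1)) \<le> \<sigma> * (p * y powr (- \<sigma> - 1))"
    using \<sigma> by (intro mult_left_mono) auto
  moreover have "(X + 1) powr (- \<sigma>) = X powr (- \<sigma>) - \<sigma> * y powr (- \<sigma> - 1)"
    "(X + c) powr (- \<sigma>) = X powr (- \<sigma>) - \<sigma> * (c * z powr (- \<sigma> - 1))"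
    using y(3) z(3) by (simp_all add: algebra_simps)
  ultimately show ?thesis
    unfolding c_def[symmetric] by (simp only: right_diff_distrib left_diff_distrib) (simp add: algebra_simps)
qed

lemma occupation_mean_powr_neg:
  fixes j :: "'b::finite" and \<sigma> e :: real
  assumes "0 < \<sigma>" "1 \<le> e"
  shows "occupation_mean k (\<lambda>n. (real (n j) + e) powr (- \<sigma>)) \<le>
    (e + real k * (2 powr (- \<sigma> - 1) / real CARD('b))) powr (- \<sigma>)"
  using assms(2)
proof (induction k arbitrary: e)
  case (Suc k)
  define p where "p = 1 / real CARD('b)"
  have p: "0 < p" "p \<le> 1" by (simp_all add: p_def Suc_leI)
  have step: "(\<Sum>i\<in>UNIV. (real ((n(i := Suc (n i))) j) + e) powr (- \<sigma>)) / real CARD('b)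
      \<le> (real (n j) + (e + p * 2 powr (- \<sigma> - 1))) powr (- \<sigma>)" for n :: "'b \<Rightarrow> nat"
  proof -
    have "(\<Sum>i\<in>UNIV. (real ((n(i := Suc (n i))) j) + e) powr (- \<sigma>)) =
        ((real (n j) + e) + 1) powr (- \<sigma>) + (\<Sum>i\<in>UNIV - {j}. (real (n j) + e) powr (- \<sigma>))"
      by (subst sum.remove[of _ j]) (auto intro!: sum.cong simp: algebra_simps)
    then have "(\<Sum>i\<in>UNIV. (real ((n(i := Suc (n i))) j) + e) powr (- \<sigma>)) / real CARD('b) =
        p * ((real (n j) + e) + 1) powr (- \<sigma>) + (1 - p) * (real (n j) + e) powr (- \<sigma>)"
      by (simp add: p_def field_simps of_nat_diff Suc_leI)
    also have "\<dots> \<le> (real (n j) + e + p * 2 powr (- \<sigma> - 1)) powr (- \<sigma>)"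
      using p assms(1) Suc.prems by (intro powr_neg_shift_average) auto
    finally show ?thesis by (simp add: algebra_simps)
  qed
  have "occupation_mean (Suc k) (\<lambda>n. (real (n j) + e) powr (- \<sigma>)) \<le>
      occupation_mean k (\<lambda>n. (real (n j) + (e + p * 2 powr (- \<sigma> - 1))) powr (- \<sigma>))"
    unfolding occupation_mean.simps by (rule occupation_mean_mono[OF step])
  also have "\<dots> \<le> (e + p * 2 powr (- \<sigma> - 1) + real k * (2 powr (- \<sigma> - 1) / real CARD('b))) powr (- \<sigma>)"
    using p Suc.prems by (intro Suc.IH) (auto intro: add_increasing2)
  also have "e + p * 2 powr (- \<sigma> - 1) + real k * (2 powr (- \<sigma> - 1) / real CARD('b)) =
      e + real (Suc k) * (2 powr (- \<sigma> - 1) / real CARD('b))"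
    by (simp add: p_def algebra_simps add_divide_distrib)
  finally show ?case .
qed simp

text \<open>
  The inequality of arithmetic and geometric means separates the coordinates: the product of the
  \<open>(n j + 1) powr (- 1/2)\<close> is at most the average of the \<open>(n j + 1) powr (- d/2)\<close>, and a single
  \<open>n j\<close> grows at a positive rate.
\<close>

lemma heat_kernel_le:
  fixes x :: "int ^ 'b::finite"
  assumes \<sigma>: "0 < \<sigma>" "\<sigma> \<le> real CARD('b) / 2"
  shows "heat_kernel k x \<le>
    (2 powr (- \<sigma> - 1) / real CARD('b)) powr (- \<sigma>) * real (Suc k) powr (- \<sigma>)"
proof -
  define d where "d = CARD('b)"
  have d: "0 < d" by (simp add: d_def)
  define c where "c = 2 powr (- \<sigma> - 1) / real d"
  have c: "0 < c" "c \<le> 1"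
  proof -
    have "2 powr (- \<sigma> - 1) \<le> (1::real)"
      using \<sigma> powr_mono[of "- \<sigma> - 1" 0 2] by simp
    then show "0 < c" "c \<le> 1" using d by (auto simp: c_def divide_simps)
  qed
  have amgm: "(\<Prod>j\<in>UNIV. line_walk (n j) (x $ j)) \<le>
      1 / real d * (\<Sum>j\<in>UNIV. (real (n j) + 1) powr (- \<sigma>))" for n :: "'b \<Rightarrow> nat"
  proof -
    have "(\<Prod>j\<in>UNIV. line_walk (n j) (x $ j)) \<le> (\<Prod>j\<in>UNIV. (real (n j) + 1) powr (- 1/2))"
      using line_walk_le
      by (intro prod_mono conjI line_walk_nonneg)
        (auto simp: powr_minus powr_half_sqrt divide_simps add.commute)
    also have "\<dots> = (\<Prod>j\<in>UNIV. (real (n j) + 1) powr (- real d / 2)) powr (1 / real d)"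
      using d by (simp add: prod_powr_distrib powr_powr)
    also have "\<dots> \<le> (\<Sum>j\<in>(UNIV::'b set). (real (n j) + 1) powr (- real d / 2) / real d)"
      unfolding d_def by (rule arith_geom_mean) auto
    also have "\<dots> \<le> (\<Sum>j\<in>UNIV. (real (n j) + 1) powr (- \<sigma>) / real d)"
      using \<sigma> d by (intro sum_mono divide_right_mono powr_mono) (auto simp: d_def)
    finally show ?thesis by (simp add: sum_divide_distrib)
  qed
  have "heat_kernel k x \<le> 1 / real d * (\<Sum>j\<in>UNIV. occupation_mean k (\<lambda>n. (real (n (j::'b)) + 1) powr (- \<sigma>)))"
    unfolding heat_kernel_def
    by (rule order_trans[OF occupation_mean_mono[OF amgm]])
      (simp only: occupation_mean_cmult occupation_mean_sum order.refl)
  also have "\<dots> \<le> 1 / real d * (\<Sum>j\<in>(UNIV::'b set). (1 + real k * c) powr (- \<sigma>))"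
    unfolding c_def d_def using \<sigma> by (intro mult_left_mono sum_mono occupation_mean_powr_neg) auto
  also have "\<dots> = (1 + real k * c) powr (- \<sigma>)" using d by (simp add: d_def)
  also have "\<dots> \<le> (c * real (Suc k)) powr (- \<sigma>)"
    using c \<sigma> by (intro powr_mono2') (auto simp: algebra_simps intro: add_pos_nonneg)
  also have "\<dots> = c powr (- \<sigma>) * real (Suc k) powr (- \<sigma>)"
    using c by (subst powr_mult) auto
  finally show ?thesis unfolding c_def d_def .
qed

section \<open>Walks with memory and the cost of forgetting\<close>

text \<open>
  Histories list the visited sites, the most recent one first. Only finitely many steps from a
  finite set are ever considered, so the expectation after \<open>n\<close> more steps is a finite sum.
\<close>

primrec path_mean ::
  "'x::plus set \<Rightarrow> ('x list \<Rightarrow> 'x \<Rightarrow> real) \<Rightarrow> nat \<Rightarrow> 'x list \<Rightarrow> ('x list \<Rightarrow> 'w::real_vector) \<Rightarrow> 'w" where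
  "path_mean U K 0 h F = F h"
| "path_mean U K (Suc n) h F = (\<Sum>u\<in>U. K h u *\<^sub>R path_mean U K n ((hd h + u) # h) F)"

locale memory_walk =
  fixes U :: "'x::ab_group_add set" and K :: "'x list \<Rightarrow> 'x \<Rightarrow> real"
  assumes finite_steps: "finite U"
    and kernel_nonneg: "u \<in> U \<Longrightarrow> 0 \<le> K h u"
    and kernel_total: "(\<Sum>u\<in>U. K h u) = 1"
begin

abbreviation E :: "nat \<Rightarrow> 'x list \<Rightarrow> ('x list \<Rightarrow> 'w::real_vector) \<Rightarrow> 'w" where
  "E \<equiv> path_mean U K"

lemma mean_cong:
  assumes "\<And>l. length l = n + length h \<Longrightarrow> drop n l = h \<Longrightarrow> F l = G l"
  shows "E n h F = E n h G"
  using assms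
proof (induction n arbitrary: h)
  case (Suc n)
  have "E n ((hd h + u) # h) F = E n ((hd h + u) # h) G" for u
  proof (rule Suc.IH)
    fix l assume l: "length l = n + length ((hd h + u) # h)" "drop n l = (hd h + u) # h"
    then have "drop (Suc n) l = h" by (metis drop_Suc drop_tl list.sel(3))
    then show "F l = G l" using l(1) by (intro Suc.prems) auto
  qed
  then show ?case by simp
qed simp

lemma mean_mono:
  fixes F G :: "'x list \<Rightarrow> real"
  assumes "\<And>l. length l = n + length h \<Longrightarrow> drop n l = h \<Longrightarrow> F l \<le> G l"
  shows "E n h F \<le> E n h G"
  using assms
proof (induction n arbitrary: h)
  case (Suc n)
  have "E n ((hd h + u) # h) F \<le> E n ((hd h + u) # h) G" for u
  proof (rule Suc.IH)
    fix l assume l: "length l = n + length ((hd h + u) # h)" "drop n l = (hd h + u) # h"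
    then have "drop (Suc n) l = h" by (metis drop_Suc drop_tl list.sel(3))
    then show "F l \<le> G l" using l(1) by (intro Suc.prems) auto
  qed
  then show ?case by (auto intro!: sum_mono mult_left_mono kernel_nonneg)
qed simp

lemma mean_const: "E n h (\<lambda>_. c) = c"
  by (induction n arbitrary: h) (simp_all add: kernel_total flip: scaleR_left.sum)

lemma mean_add: "E n h (\<lambda>l. F l + G l) = E n h F + E n h G"
  by (induction n arbitrary: h) (simp_all add: scaleR_right_distrib sum.distrib)

lemma mean_diff: "E n h (\<lambda>l. F l - G l) = E n h F - E n h G"
  by (induction n arbitrary: h) (simp_all add: scaleR_right_diff_distrib sum_subtractf)

lemma mean_sum: "E n h (\<lambda>l. \<Sum>i\<in>I. F i l) = (\<Sum>i\<in>I. E n h (F i))"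
  by (induction I rule: infinite_finite_induct) (simp_all add: mean_const mean_add)

lemma mean_linear: "linear \<phi> \<Longrightarrow> E n h (\<lambda>l. \<phi> (F l)) = \<phi> (E n h F)"
  by (induction n arbitrary: h) (simp_all add: linear_sum linear_scale)

lemma mean_cmult: "E n h (\<lambda>l. c * F l) = c * E n h (F :: 'x list \<Rightarrow> real)"
  by (rule mean_linear) (simp add: linear_times)

lemma mean_nonneg: "(\<And>l. 0 \<le> F l) \<Longrightarrow> 0 \<le> E n h (F :: 'x list \<Rightarrow> real)"
  using mean_mono[of n h "\<lambda>_. 0" F] by (simp add: mean_const)

lemma norm_mean_le: "norm (E n h F) \<le> E n h (\<lambda>l. norm (F l))"
  for F :: "'x list \<Rightarrow> 'w::real_normed_vector"
proof (induction n arbitrary: h)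
  case (Suc n)
  have "norm (E (Suc n) h F) \<le> (\<Sum>u\<in>U. norm (K h u *\<^sub>R E n ((hd h + u) # h) F))"
    unfolding path_mean.simps by (rule norm_sum)
  also have "\<dots> \<le> (\<Sum>u\<in>U. K h u *\<^sub>R E n ((hd h + u) # h) (\<lambda>l. norm (F l)))"
    by (intro sum_mono) (auto simp: kernel_nonneg intro!: mult_left_mono Suc.IH)
  finally show ?case by simp
qed simp

lemma mean_tower: "E (m + n) h F = E m h (\<lambda>l. E n l F)"
  by (induction m arbitrary: h) simp_all

lemma mean_Suc_last: "E (Suc n) h F = E n h (\<lambda>l. \<Sum>u\<in>U. K l u *\<^sub>R F ((hd l + u) # l))"
  using mean_tower[of n 1 h F] by simp

end

text \<open>
  The memory acts locally: forgetting the part \<open>g\<close> of the past has no influence on the next step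
  unless the current site lies in \<open>g\<close>. In the weighted Green function bound the factor \<open>j + 1\<close> is
  the number of sites seen up to time \<open>j\<close>, and \<open>min (j + 1) N\<close> counts the \<open>k < N\<close> with \<open>k \<le> j\<close>.
\<close>

locale local_memory_walk = memory_walk U K
  for U :: "'x::ab_group_add set" and K :: "'x list \<Rightarrow> 'x \<Rightarrow> real" +
  fixes \<epsilon> :: real and \<iota> :: "'x \<Rightarrow> 'v::euclidean_space" and \<Gamma> :: "nat \<Rightarrow> real"
  assumes kernel_translate: "h \<noteq> [] \<Longrightarrow> K (map ((+) z) h) u = K h u"
    and kernel_local: "z \<notin> set g \<Longrightarrow> K ((z # h) @ g) u = K (z # h) u"
    and kernel_close: "u \<in> U \<Longrightarrow> \<bar>K h u - K h' u\<bar> \<le> \<epsilon>"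
    and step_add: "\<iota> (x + y) = \<iota> x + \<iota> y"
    and step_norm: "u \<in> U \<Longrightarrow> norm (\<iota> u) \<le> 1"
    and green_bound: "h \<noteq> [] \<Longrightarrow>
      (\<Sum>j<M. real (j + 1) * real (min (j + 1) N) * E j h (\<lambda>l. of_bool (hd l = z))) \<le> \<Gamma> N"
    and small: "3 * (\<epsilon> * card U) * \<Gamma> 1 \<le> 1"
begin

definition drift :: "'x list \<Rightarrow> 'v" where
  "drift h = (\<Sum>u\<in>U. K h u *\<^sub>R \<iota> u)"

definition velocity :: "nat \<Rightarrow> 'x list \<Rightarrow> 'v" where
  "velocity m h = E m h drift"

lemma eps_nonneg: "0 \<le> \<epsilon>"
proof -
  have "U \<noteq> {}" using kernel_total[of "[]"] by auto
  then obtain u where "u \<in> U" by auto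
  from kernel_close[OF this, of "[]" "[]"] show ?thesis by simp
qed

lemma velocity_Suc: "velocity (Suc m) h = (\<Sum>u\<in>U. K h u *\<^sub>R velocity m ((hd h + u) # h))"
  by (simp add: velocity_def)

lemma norm_drift_le: "norm (drift h) \<le> 1"
proof -
  have "norm (drift h) \<le> (\<Sum>u\<in>U. K h u)"
    unfolding drift_def using kernel_nonneg step_norm
    by (intro order_trans[OF norm_sum] sum_mono) (auto simp: mult_left_le)
  then show ?thesis by (simp add: kernel_total)
qed

lemma norm_velocity_le: "norm (velocity m h) \<le> 1"
  unfolding velocity_def using mean_mono[of m h "\<lambda>l. norm (drift l)" "\<lambda>_. 1"] norm_drift_le
  by (intro order_trans[OF norm_mean_le]) (simp add: mean_const)

lemma velocity_translate: "h \<noteq> [] \<Longrightarrow> velocity m (map ((+) z) h) = velocity m h"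
proof (induction m arbitrary: h)
  case 0
  then show ?case by (simp add: velocity_def drift_def kernel_translate)
next
  case (Suc m)
  have "velocity m ((hd (map ((+) z) h) + u) # map ((+) z) h) = velocity m ((hd h + u) # h)" for u
    using Suc.IH[of "(hd h + u) # h"] Suc.prems by (simp add: hd_map add.assoc)
  then show ?case by (simp add: velocity_Suc kernel_translate Suc.prems)
qed

lemma velocity_singleton: "velocity m [y] = velocity m [0]"
  using velocity_translate[of "[0]" m y] by simp

text \<open>
  By translation invariance, the mean steps of a walk without past are those of the walk started
  at \<open>0\<close>, wherever it starts.
\<close>

definition memory_effect :: "nat \<Rightarrow> 'x list \<Rightarrow> 'x \<Rightarrow> real" where
  "memory_effect m g y = norm (velocity m (y # g) - velocity m [0])"

lemma memory_effect_nonneg: "0 \<le> memory_effect m g y"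
  by (simp add: memory_effect_def)

text \<open>
  A bound for the error, in the mean of the \<open>r\<close>-th step after the present one, that results from
  replacing the transition probabilities after the history \<open>h @ g\<close> by those after \<open>h\<close> in the
  present step. Both have the same total mass, so a constant, the mean step of a walk without past,
  may be subtracted from what follows; this is where \<open>memory_effect\<close> reappears.
\<close>

definition discrepancy :: "nat \<Rightarrow> 'x list \<Rightarrow> 'x list \<Rightarrow> real" where
  "discrepancy r h g = of_bool (hd h \<in> set g) *
     (\<epsilon> * (\<Sum>u\<in>U. case r of 0 \<Rightarrow> 1 | Suc r \<Rightarrow> memory_effect r h (hd h + u)))"

lemma kernel_local': "h \<noteq> [] \<Longrightarrow> hd h \<notin> set g \<Longrightarrow> K (h @ g) u = K h u"
  using kernel_local[of "hd h" g "tl h" u] by simp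

lemma discrepancy_drift:
  assumes "h \<noteq> []"
  shows "norm (drift (h @ g) - drift h) \<le> discrepancy 0 h g"
proof (cases "hd h \<in> set g")
  case True
  have "norm (drift (h @ g) - drift h) = norm (\<Sum>u\<in>U. (K (h @ g) u - K h u) *\<^sub>R \<iota> u)"
    by (simp add: drift_def scaleR_left_diff_distrib sum_subtractf)
  also have "\<dots> \<le> (\<Sum>u\<in>U. \<epsilon> * 1)"
    unfolding norm_scaleR real_norm_def using eps_nonneg
    by (intro order_trans[OF norm_sum] sum_mono, unfold norm_scaleR real_norm_def)
      (intro mult_mono kernel_close step_norm; simp)
  finally show ?thesis using True by (simp add: discrepancy_def sum_distrib_left mult.commute)
next
  case False
  then show ?thesis using assms by (simp add: drift_def kernel_local' discrepancy_def)
qed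

lemma discrepancy_velocity:
  assumes "h \<noteq> []"
  shows "norm (\<Sum>u\<in>U. (K (h @ g) u - K h u) *\<^sub>R velocity m ((hd h + u) # h))
    \<le> discrepancy (Suc m) h g"
proof (cases "hd h \<in> set g")
  case True
  have "(\<Sum>u\<in>U. (K (h @ g) u - K h u) *\<^sub>R velocity m ((hd h + u) # h)) =
      (\<Sum>u\<in>U. (K (h @ g) u - K h u) *\<^sub>R (velocity m ((hd h + u) # h) - velocity m [0]))"
    by (simp add: scaleR_right_diff_distrib sum_subtractf kernel_total
        flip: scaleR_left.sum)
  also have "norm \<dots> \<le> (\<Sum>u\<in>U. \<epsilon> * memory_effect m h (hd h + u))"
    using kernel_close by (intro order_trans[OF norm_sum] sum_mono)
      (auto simp: memory_effect_def intro!: mult_right_mono)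
  finally show ?thesis using True by (simp add: discrepancy_def sum_distrib_left)
next
  case False
  then show ?thesis using assms by (simp add: kernel_local' discrepancy_def)
qed

text \<open>
  Duhamel's formula: up to time \<open>j\<close> the walk uses its whole memory, at time \<open>j\<close> it switches, and
  from then on it only uses what it has seen since \<open>g\<close>, which is a prefix of the history.
\<close>

lemma forgetting_cost:
  assumes "h \<noteq> []"
  shows "norm (velocity m (h @ g) - velocity m h) \<le>
    (\<Sum>j\<le>m. E j (h @ g) (\<lambda>l. discrepancy (m - j) (take (length l - length g) l) g))"
  using assms
proof (induction m arbitrary: h)
  case 0
  then show ?case using discrepancy_drift by (simp add: velocity_def)
next
  case (Suc m)
  let ?h = "\<lambda>u. (hd h + u) # h"
  let ?R = "\<lambda>r l. discrepancy r (take (length l - length g) l) g"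
  have hd: "hd (h @ g) = hd h" using Suc.prems by simp
  have IH: "norm (velocity m (?h u @ g) - velocity m (?h u)) \<le>
      (\<Sum>j\<le>m. E j (?h u @ g) (?R (m - j)))" for u
    by (rule Suc.IH) simp
  let ?X = "\<Sum>u\<in>U. (K (h @ g) u - K h u) *\<^sub>R velocity m (?h u)"
  let ?Y = "\<Sum>u\<in>U. K (h @ g) u *\<^sub>R (velocity m (?h u @ g) - velocity m (?h u))"
  have split: "velocity (Suc m) (h @ g) - velocity (Suc m) h = ?X + ?Y"
    by (simp add: velocity_Suc hd scaleR_left_diff_distrib scaleR_right_diff_distrib sum_subtractf)
  have "norm ?Y \<le> (\<Sum>u\<in>U. norm (K (h @ g) u *\<^sub>R (velocity m (?h u @ g) - velocity m (?h u))))"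
    by (rule norm_sum)
  also have "\<dots> \<le> (\<Sum>u\<in>U. K (h @ g) u * (\<Sum>j\<le>m. E j (?h u @ g) (?R (m - j))))"
  proof (rule sum_mono)
    fix u assume "u \<in> U"
    then show "norm (K (h @ g) u *\<^sub>R (velocity m (?h u @ g) - velocity m (?h u))) \<le>
        K (h @ g) u * (\<Sum>j\<le>m. E j (?h u @ g) (?R (m - j)))"
      using mult_left_mono[OF IH[of u] kernel_nonneg[of u "h @ g"]] kernel_nonneg[of u "h @ g"] by simp
  qed
  also have "\<dots> = (\<Sum>j\<le>m. E (Suc j) (h @ g) (?R (Suc m - Suc j)))"
    unfolding sum_distrib_left by (subst sum.swap) (simp add: hd)
  finally have Y: "norm ?Y \<le> (\<Sum>j\<le>m. E (Suc j) (h @ g) (?R (Suc m - Suc j)))" .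
  have X: "norm ?X \<le> E 0 (h @ g) (?R (Suc m - 0))"
    using discrepancy_velocity[OF Suc.prems, of g m] by simp
  show ?case
    unfolding split sum.atMost_Suc_shift by (rule norm_triangle_le[OF add_mono[OF X Y]])
qed

definition weight :: "nat \<Rightarrow> nat \<Rightarrow> real" where
  "weight N j = real (min (j + 1) N)"

lemma weight_nonneg: "0 \<le> weight N j"
  by (simp add: weight_def)

lemma weight_Suc_add_le: "weight N (Suc (i + j)) \<le> weight N i + weight N j"
  by (simp add: weight_def min_def)

abbreviation visit :: "nat \<Rightarrow> 'x list \<Rightarrow> 'x \<Rightarrow> real" where
  "visit j h z \<equiv> E j h (\<lambda>l. of_bool (hd l = z))"

abbreviation revisit :: "nat \<Rightarrow> 'x list \<Rightarrow> 'x list \<Rightarrow> real" where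
  "revisit j h g \<equiv> E j h (\<lambda>l. of_bool (hd l \<in> set g))"

text \<open>
  One round of the recursion for the total effect of forgetting \<open>g\<close>. After a switch at time \<open>j\<close>
  the remaining effect is that of forgetting \<open>j + 1\<close> sites, and the weight of a step that follows
  \<open>r\<close> steps after the switch splits by \<open>weight_Suc_add_le\<close>, so that the bounds \<open>A\<^sub>1\<close> and \<open>A\<close> for a
  horizon \<open>M\<close> give a bound for the horizon \<open>M + 1\<close>.
\<close>

lemma memory_effect_sum_step:
  fixes A\<^sub>1 A :: real
  assumes A1: "\<And>g y. (\<Sum>m<M. memory_effect m g y) \<le> A\<^sub>1 * length g"
    and A: "\<And>g y. (\<Sum>m<M. weight N m * memory_effect m g y) \<le> A * length g"
    and nonneg: "0 \<le> A\<^sub>1" "0 \<le> A"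
  shows "(\<Sum>m<Suc M. weight N m * memory_effect m g y) \<le>
    \<epsilon> * card U * (\<Sum>j<Suc M. real (j + 1) * (weight N j * (1 + A\<^sub>1) + A) * revisit j (y # g) g)"
proof -
  let ?h = "\<lambda>j l. take (Suc j) l :: 'x list"
  let ?D = "\<lambda>r h u. memory_effect r h (hd h + u)"
  have trunc: "(\<Sum>r<M'. weight N r * memory_effect r g y) \<le> A * length g"
    "(\<Sum>r<M'. memory_effect r g y) \<le> A\<^sub>1 * length g" if "M' \<le> M" for M' g y
    by (rule order_trans[OF sum_mono2 A]; use that weight_nonneg memory_effect_nonneg in simp)
      (rule order_trans[OF sum_mono2 A1]; use that memory_effect_nonneg in simp)
  have inner: "(\<Sum>r\<le>M - j. weight N (j + r) * discrepancy r (?h j l) g) \<le>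
      \<epsilon> * card U * (real (j + 1) * (weight N j * (1 + A\<^sub>1) + A)) * of_bool (hd l \<in> set g)"
    if l: "length l = j + length (y # g)" for j l
  proof -
    have len: "length (?h j l) = j + 1" and hd: "hd (?h j l) = hd l"
      using l by (auto simp: hd_conv_nth)
    have each: "(\<Sum>r\<le>M - j. weight N (j + r) * (case r of 0 \<Rightarrow> 1 | Suc r \<Rightarrow> ?D r (?h j l) u)) \<le>
        real (j + 1) * (weight N j * (1 + A\<^sub>1) + A)" for u
    proof -
      have "(\<Sum>r\<le>M - j. weight N (j + r) * (case r of 0 \<Rightarrow> 1 | Suc r \<Rightarrow> ?D r (?h j l) u)) =
          weight N j + (\<Sum>r<M - j. weight N (Suc (j + r)) * ?D r (?h j l) u)"
        by (subst sum.atMost_shift) simp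
      also have "\<dots> \<le> weight N j + (\<Sum>r<M - j. (weight N j + weight N r) * ?D r (?h j l) u)"
        by (intro add_left_mono sum_mono mult_right_mono weight_Suc_add_le memory_effect_nonneg)
      also have "\<dots> = weight N j + (weight N j * (\<Sum>r<M - j. ?D r (?h j l) u) +
          (\<Sum>r<M - j. weight N r * ?D r (?h j l) u))"
        by (simp add: distrib_right sum.distrib sum_distrib_left)
      also have "\<dots> \<le> weight N j * real (j + 1) + (weight N j * (A\<^sub>1 * length (?h j l)) + A * length (?h j l))"
        by (intro add_mono mult_left_mono trunc weight_nonneg) (simp_all add: weight_nonneg ring_distribs)
      finally show ?thesis unfolding len by (simp add: algebra_simps)
    qed
    have "(\<Sum>r\<le>M - j. weight N (j + r) * discrepancy r (?h j l) g) =
        of_bool (hd l \<in> set g) * (\<epsilon> * (\<Sum>u\<in>U. \<Sum>r\<le>M - j.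
          weight N (j + r) * (case r of 0 \<Rightarrow> 1 | Suc r \<Rightarrow> ?D r (?h j l) u)))"
      unfolding discrepancy_def hd
      by (subst sum.swap) (simp add: sum_distrib_left mult.left_commute)
    also have "\<dots> \<le> of_bool (hd l \<in> set g) * (\<epsilon> * (\<Sum>u\<in>U. real (j + 1) * (weight N j * (1 + A\<^sub>1) + A)))"
      using eps_nonneg by (intro mult_left_mono sum_mono each) auto
    finally show ?thesis by (simp add: ac_simps)
  qed
  have "(\<Sum>m<Suc M. weight N m * memory_effect m g y) \<le>
      (\<Sum>m\<le>M. \<Sum>j\<le>m. weight N m * E j (y # g) (\<lambda>l. discrepancy (m - j) (?h j l) g))"
    unfolding lessThan_Suc_atMost
  proof (rule sum_mono)
    fix m
    have "memory_effect m g y \<le>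
        (\<Sum>j\<le>m. E j (y # g) (\<lambda>l. discrepancy (m - j) (take (length l - length g) l) g))"
      using forgetting_cost[of "[y]" m g] by (simp add: memory_effect_def velocity_singleton[of m y])
    also have "\<dots> = (\<Sum>j\<le>m. E j (y # g) (\<lambda>l. discrepancy (m - j) (?h j l) g))"
      by (intro sum.cong mean_cong refl) simp
    finally show "weight N m * memory_effect m g y \<le>
        (\<Sum>j\<le>m. weight N m * E j (y # g) (\<lambda>l. discrepancy (m - j) (?h j l) g))"
      unfolding sum_distrib_left[symmetric] by (rule mult_left_mono[OF _ weight_nonneg])
  qed
  also have "\<dots> = (\<Sum>j\<le>M. \<Sum>r\<le>M - j. weight N (j + r) * E j (y # g) (\<lambda>l. discrepancy r (?h j l) g))"
  proof -
    define G where "G j r = weight N (j + r) * E j (y # g) (\<lambda>l. discrepancy r (?h j l) g)" for j r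
    have "(\<Sum>m\<le>M. \<Sum>j\<le>m. weight N m * E j (y # g) (\<lambda>l. discrepancy (m - j) (?h j l) g)) =
        (\<Sum>m\<le>M. \<Sum>j\<le>m. G j (m - j))"
      by (intro sum.cong refl) (simp add: G_def)
    also have "\<dots> = (\<Sum>(j, r)\<in>{(i, j). i + j \<le> M}. G j r)"
      by (rule sum.triangle_reindex_eq[symmetric])
    also have "{(i, j). i + j \<le> M} = Sigma {..M} (\<lambda>i. {..M - i})" by auto
    also have "(\<Sum>(j, r)\<in>Sigma {..M} (\<lambda>i. {..M - i}). G j r) = (\<Sum>j\<le>M. \<Sum>r\<le>M - j. G j r)"
      by (rule sum.Sigma[symmetric]) auto
    finally show ?thesis unfolding G_def .
  qed
  also have "\<dots> = (\<Sum>j\<le>M. E j (y # g) (\<lambda>l. \<Sum>r\<le>M - j. weight N (j + r) * discrepancy r (?h j l) g))"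
    by (simp add: mean_sum mean_cmult)
  also have "\<dots> \<le> (\<Sum>j\<le>M. E j (y # g) (\<lambda>l. \<epsilon> * card U *
      (real (j + 1) * (weight N j * (1 + A\<^sub>1) + A)) * of_bool (hd l \<in> set g)))"
    by (rule sum_mono, rule mean_mono, rule inner)
  also have "\<dots> = \<epsilon> * card U * (\<Sum>j<Suc M. real (j + 1) * (weight N j * (1 + A\<^sub>1) + A) * revisit j (y # g) g)"
    by (simp add: mean_cmult sum_distrib_left mult.assoc lessThan_Suc_atMost)
  finally show ?thesis .
qed

end

context local_memory_walk
begin

definition \<kappa> :: real where "\<kappa> = \<epsilon> * card U"

lemma kappa_nonneg: "0 \<le> \<kappa>"
  by (simp add: \<kappa>_def eps_nonneg)

lemma green_nonneg: "0 \<le> \<Gamma> N"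
  using green_bound[where h = "[0]" and M = 0 and N = N] by simp

lemma weighted_visits_le:
  assumes "h \<noteq> []"
  shows "(\<Sum>j<M. real (j + 1) * weight N j * visit j h z) \<le> \<Gamma> N"
  using green_bound[OF assms] by (simp add: weight_def)

lemma of_bool_mem_le_sum: "of_bool (z \<in> set g) \<le> (\<Sum>t<length g. of_bool (z = g ! t) :: real)"
proof (cases "z \<in> set g")
  case True
  then obtain t where "t < length g" "z = g ! t" by (auto simp: in_set_conv_nth)
  then show ?thesis
    using member_le_sum[of t "{..<length g}" "\<lambda>t. of_bool (z = g ! t) :: real"] by simp
qed (simp add: sum_nonneg)

lemma weighted_revisits_le:
  "(\<Sum>j<M. real (j + 1) * weight N j * revisit j (y # g) g) \<le> \<Gamma> N * length g"
proof -
  have "(\<Sum>j<M. real (j + 1) * weight N j * revisit j (y # g) g) \<le>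
      (\<Sum>j<M. real (j + 1) * weight N j * (\<Sum>t<length g. visit j (y # g) (g ! t)))"
    unfolding mean_sum[symmetric]
    by (intro sum_mono mult_left_mono mean_mono of_bool_mem_le_sum) (simp add: weight_nonneg)
  also have "\<dots> = (\<Sum>t<length g. \<Sum>j<M. real (j + 1) * weight N j * visit j (y # g) (g ! t))"
    by (subst sum.swap) (simp add: sum_distrib_left)
  also have "\<dots> \<le> (\<Sum>t<length g. \<Gamma> N)"
    by (intro sum_mono weighted_visits_le) simp
  finally show ?thesis by (simp add: mult.commute)
qed

lemma revisits_le:
  "(\<Sum>j<M. real (j + 1) * revisit j (y # g) g) \<le> \<Gamma> 1 * length g"
  using weighted_revisits_le[where N = 1] by (simp add: weight_def)

text \<open>
  With \<open>N = 1\<close> all weights are \<open>1\<close>, and the constants \<open>A\<^sub>1 = A = 1\<close> reproduce themselves because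
  \<open>3 \<kappa> \<Gamma> 1 \<le> 1\<close>.
\<close>

lemma memory_effect_sum_le_length: "(\<Sum>m<M. memory_effect m g y) \<le> real (length g)"
proof (induction M arbitrary: g y)
  case (Suc M)
  have w: "weight (Suc 0) m = 1" for m by (simp add: weight_def)
  have "(\<Sum>m<Suc M. memory_effect m g y) \<le>
      \<kappa> * (\<Sum>j<Suc M. real (j + 1) * (1 * (1 + 1) + 1) * revisit j (y # g) g)"
    using memory_effect_sum_step[of M 1 1 1 g y] Suc.IH by (simp add: w \<kappa>_def)
  also have "\<dots> = 3 * \<kappa> * (\<Sum>j<Suc M. real (j + 1) * revisit j (y # g) g)"
    by (simp add: sum_distrib_left algebra_simps)
  also have "\<dots> \<le> 3 * \<kappa> * (\<Gamma> 1 * length g)"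
    using kappa_nonneg by (intro mult_left_mono revisits_le) auto
  also have "\<dots> \<le> real (length g)"
    using mult_right_mono[OF small, of "length g"] by (simp add: \<kappa>_def mult.assoc)
  finally show ?case .
qed simp

text \<open>
  Stopping the recursion after one round keeps the information when the forgotten sites are
  visited, which a bound by the length of \<open>g\<close> loses.
\<close>

lemma memory_effect_sum_le_revisits:
  "(\<Sum>m<M. memory_effect m g y) \<le> 3 * \<kappa> * (\<Sum>j<M. real (j + 1) * revisit j (y # g) g)"
proof (cases M)
  case (Suc M')
  have w: "weight (Suc 0) m = 1" for m by (simp add: weight_def)
  have "(\<Sum>m<Suc M'. memory_effect m g y) \<le>
      \<kappa> * (\<Sum>j<Suc M'. real (j + 1) * (1 * (1 + 1) + 1) * revisit j (y # g) g)"
    using memory_effect_sum_step[of M' 1 1 1 g y] memory_effect_sum_le_length by (simp add: w \<kappa>_def)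
  also have "\<dots> = 3 * \<kappa> * (\<Sum>j<Suc M'. real (j + 1) * revisit j (y # g) g)"
    by (simp add: sum_distrib_left algebra_simps)
  finally show ?thesis using Suc by simp
qed simp

text \<open>
  The constant \<open>A = 3 \<kappa> \<Gamma> N\<close> reproduces itself:
  \<open>\<kappa> (2 \<Gamma> N + A \<Gamma> 1) = 2/3 A + 1/3 A (3 \<kappa> \<Gamma> 1) \<le> A\<close>.
\<close>

lemma weighted_memory_effect_le:
  "(\<Sum>m<M. weight N m * memory_effect m g y) \<le> 3 * \<kappa> * \<Gamma> N * length g"
proof (induction M arbitrary: g y)
  case 0
  then show ?case by (simp add: kappa_nonneg green_nonneg)
next
  case (Suc M)
  define A where "A = 3 * \<kappa> * \<Gamma> N"
  have A: "0 \<le> A" by (simp add: A_def kappa_nonneg green_nonneg)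
  have "(\<Sum>m<Suc M. weight N m * memory_effect m g y) \<le>
      \<kappa> * (\<Sum>j<Suc M. real (j + 1) * (weight N j * (1 + 1) + A) * revisit j (y # g) g)"
    unfolding \<kappa>_def
    using memory_effect_sum_le_length Suc.IH[folded A_def] A by (intro memory_effect_sum_step) auto
  also have "\<dots> = \<kappa> * (2 * (\<Sum>j<Suc M. real (j + 1) * weight N j * revisit j (y # g) g) +
      A * (\<Sum>j<Suc M. real (j + 1) * revisit j (y # g) g))"
    unfolding sum_distrib_left sum.distrib[symmetric]
    by (intro sum.cong refl) (simp add: algebra_simps)
  also have "\<dots> \<le> \<kappa> * (2 * (\<Gamma> N * length g) + A * (\<Gamma> 1 * length g))"
    using kappa_nonneg A
    by (intro mult_left_mono add_mono weighted_revisits_le revisits_le) auto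
  also have "\<dots> = (2 / 3 * A + A / 3 * (3 * \<kappa> * \<Gamma> 1)) * length g"
    by (simp add: A_def algebra_simps)
  also have "\<dots> \<le> (2 / 3 * A + A / 3 * 1) * length g"
    using small A by (intro mult_right_mono add_left_mono mult_left_mono) (auto simp: \<kappa>_def)
  finally show ?case unfolding A_def[symmetric] by simp
qed

section \<open>The asymptotic velocity\<close>

text \<open>
  After its first step \<open>u\<close> the walk from \<open>0\<close> is a walk from \<open>u\<close> that remembers \<open>0\<close>.
\<close>

lemma velocity_increment_le:
  "norm (velocity (Suc m) [0] - velocity m [0]) \<le> (\<Sum>u\<in>U. K [0] u * memory_effect m [0] u)"
proof -
  have "velocity (Suc m) [0] - velocity m [0] =
      (\<Sum>u\<in>U. K [0] u *\<^sub>R (velocity m [u, 0] - velocity m [0]))"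
    by (simp add: velocity_Suc scaleR_right_diff_distrib sum_subtractf kernel_total flip: scaleR_left.sum)
  then show ?thesis
    using kernel_nonneg by (auto simp: memory_effect_def intro!: order_trans[OF norm_sum] sum_mono)
qed

lemma weighted_velocity_increments_le:
  "(\<Sum>m<M. weight N m * norm (velocity (Suc m) [0] - velocity m [0])) \<le> 3 * \<kappa> * \<Gamma> N"
proof -
  have "(\<Sum>m<M. weight N m * norm (velocity (Suc m) [0] - velocity m [0])) \<le>
      (\<Sum>m<M. weight N m * (\<Sum>u\<in>U. K [0] u * memory_effect m [0] u))"
    by (intro sum_mono mult_left_mono velocity_increment_le weight_nonneg)
  also have "\<dots> = (\<Sum>u\<in>U. K [0] u * (\<Sum>m<M. weight N m * memory_effect m [0] u))"
    unfolding sum_distrib_left by (subst sum.swap) (simp add: mult.left_commute)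
  also have "\<dots> \<le> (\<Sum>u\<in>U. K [0] u * (3 * \<kappa> * \<Gamma> N))"
    using weighted_memory_effect_le[where g = "[0]"]
    by (intro sum_mono mult_left_mono kernel_nonneg) auto
  finally show ?thesis by (simp add: kernel_total flip: sum_distrib_right)
qed

definition speed :: 'v where
  "speed = lim (\<lambda>m. velocity m [0])"

lemma velocity_tendsto: "(\<lambda>m. velocity m [0]) \<longlonglongrightarrow> speed"
proof -
  have "summable (\<lambda>m. norm (velocity (Suc m) [0] - velocity m [0]))"
    using weighted_velocity_increments_le[where N = 1]
    by (intro summableI_nonneg_bounded) (auto simp: weight_def)
  then have "summable (\<lambda>m. velocity (Suc m) [0] - velocity m [0])"
    by (rule summable_norm_cancel)
  then have "convergent (\<lambda>n. \<Sum>m<n. velocity (Suc m) [0] - velocity m [0])"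
    by (simp add: summable_iff_convergent)
  then have "convergent (\<lambda>n. velocity n [0] - velocity 0 [0])"
    using sum_lessThan_telescope[of "\<lambda>m. velocity m [0]"] by simp
  then have "convergent (\<lambda>n. velocity n [0])"
    by (simp add: convergent_diff_const_right_iff)
  then show ?thesis unfolding speed_def by (simp add: convergent_LIMSEQ_iff)
qed

text \<open>
  The increment number \<open>m\<close> enters \<open>velocity k [0] - speed\<close> for all \<open>k \<le> m\<close>, that is, for
  \<open>min (m + 1) n\<close> of the indices \<open>k < n\<close>. This is the reason for the choice of the weights.
\<close>

lemma velocity_error_sum_le: "(\<Sum>k<n. norm (velocity k [0] - speed)) \<le> 3 * \<kappa> * \<Gamma> n"
proof (rule tendsto_upperbound)
  show "(\<lambda>L. \<Sum>k<n. norm (velocity k [0] - velocity L [0])) \<longlonglongrightarrow> (\<Sum>k<n. norm (velocity k [0] - speed))"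
    by (intro tendsto_intros velocity_tendsto)
  let ?d = "\<lambda>m. norm (velocity (Suc m) [0] - velocity m [0])"
  have "(\<Sum>k<n. norm (velocity k [0] - velocity L [0])) \<le> 3 * \<kappa> * \<Gamma> n" if "n \<le> L" for L
  proof -
    have "norm (velocity k [0] - velocity L [0]) \<le> (\<Sum>m<L. of_bool (k \<le> m) * ?d m)" if "k < n" for k
    proof -
      have "velocity L [0] - velocity k [0] = (\<Sum>m=k..<L. velocity (Suc m) [0] - velocity m [0])"
        using \<open>k < n\<close> \<open>n \<le> L\<close> sum_Suc_diff'[of k L "\<lambda>m. velocity m [0]"] by simp
      then have "norm (velocity k [0] - velocity L [0]) \<le> (\<Sum>m=k..<L. ?d m)"
        using norm_sum[of "\<lambda>m. velocity (Suc m) [0] - velocity m [0]" "{k..<L}"]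
        by (simp add: norm_minus_commute)
      also have "\<dots> = (\<Sum>m<L. of_bool (k \<le> m) * ?d m)"
        by (rule sum.mono_neutral_cong_left) (use that \<open>n \<le> L\<close> in auto)
      finally show ?thesis .
    qed
    then have "(\<Sum>k<n. norm (velocity k [0] - velocity L [0])) \<le>
        (\<Sum>k<n. \<Sum>m<L. of_bool (k \<le> m) * ?d m)"
      by (intro sum_mono) auto
    also have "\<dots> = (\<Sum>m<L. weight n m * ?d m)"
    proof (subst sum.swap, rule sum.cong[OF refl])
      fix m
      have "(\<Sum>k<n. of_bool (k \<le> m) :: real) = card {k. k < n \<and> k \<le> m}"
        by (simp add: Int_def lessThan_def)
      also have "{k. k < n \<and> k \<le> m} = {..<min (m + 1) n}" by auto
      finally show "(\<Sum>k<n. of_bool (k \<le> m) * ?d m) = weight n m * ?d m"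
        by (simp add: weight_def flip: sum_distrib_right)
    qed
    also have "\<dots> \<le> 3 * \<kappa> * \<Gamma> n" by (rule weighted_velocity_increments_le)
    finally show ?thesis .
  qed
  then show "\<forall>\<^sub>F L in sequentially. (\<Sum>k<n. norm (velocity k [0] - velocity L [0])) \<le> 3 * \<kappa> * \<Gamma> n"
    by (auto simp: eventually_sequentially)
qed simp

lemma step_zero: "\<iota> 0 = 0"
  using step_add[of 0 0] by simp

lemma mean_position: "E n h (\<lambda>l. \<iota> (hd l)) = \<iota> (hd h) + (\<Sum>m<n. velocity m h)"
proof (induction n)
  case (Suc n)
  have "E (Suc n) h (\<lambda>l. \<iota> (hd l)) = E n h (\<lambda>l. \<iota> (hd l) + drift l)"
    unfolding mean_Suc_last
    by (simp add: step_add scaleR_right_distrib sum.distrib drift_def kernel_total flip: scaleR_left.sum)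
  then show ?case by (simp add: mean_add Suc velocity_def)
qed simp

theorem mean_position_error:
  "norm (E n [0] (\<lambda>l. \<iota> (hd l)) - real n *\<^sub>R speed) \<le> 3 * \<kappa> * \<Gamma> n"
proof -
  have "E n [0] (\<lambda>l. \<iota> (hd l)) - real n *\<^sub>R speed = (\<Sum>m<n. velocity m [0] - speed)"
    by (simp add: mean_position step_zero sum_subtractf sum_constant_scaleR)
  then show ?thesis
    using order_trans[OF norm_sum velocity_error_sum_le, of n] by simp
qed

section \<open>The second moment\<close>

lemma norm_speed_le: "norm speed \<le> 1"
  by (rule tendsto_upperbound[OF tendsto_norm[OF velocity_tendsto]]) (simp_all add: norm_velocity_le)

definition velocity_error :: "nat \<Rightarrow> 'x list \<Rightarrow> real" where
  "velocity_error n h = (\<Sum>m<n. norm (velocity m h - speed))"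

definition spread :: "nat \<Rightarrow> 'x list \<Rightarrow> real" where
  "spread n h = E n h (\<lambda>l. (norm (\<iota> (hd l) - \<iota> (hd h) - real n *\<^sub>R speed))\<^sup>2)"

text \<open>
  Expanding the square at the first step \<open>u\<close>: the cross term is the inner product of \<open>\<iota> u - speed\<close>
  with the mean error of the remaining walk, which is a sum of velocity errors.
\<close>

lemma spread_Suc_le:
  "spread (Suc n) h \<le> 4 + 4 * E 1 h (velocity_error n) + (\<Sum>u\<in>U. K h u * spread n ((hd h + u) # h))"
proof -
  let ?h = "\<lambda>u. (hd h + u) # h"
  have step: "E n (?h u) (\<lambda>l. (norm (\<iota> (hd l) - \<iota> (hd h) - real (Suc n) *\<^sub>R speed))\<^sup>2)
      \<le> 4 + 4 * velocity_error n (?h u) + spread n (?h u)" if "u \<in> U" for u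
  proof -
    define a where "a = \<iota> u - speed"
    have a: "norm a \<le> 2"
      unfolding a_def using norm_triangle_ineq4[of "\<iota> u" speed] step_norm[OF that] norm_speed_le by linarith
    let ?Z = "\<lambda>l. \<iota> (hd l) - \<iota> (hd h + u) - real n *\<^sub>R speed"
    have shift: "\<iota> (hd l) - \<iota> (hd h) - real (Suc n) *\<^sub>R speed = ?Z l + a" for l
      by (simp add: a_def step_add scaleR_left_distrib)
    have square: "(norm (z + a))\<^sup>2 = (norm z)\<^sup>2 + 2 * inner a z + (norm a)\<^sup>2" for z
      by (simp add: power2_norm_eq_inner inner_simps inner_commute)
    have "E n (?h u) (\<lambda>l. (norm (\<iota> (hd l) - \<iota> (hd h) - real (Suc n) *\<^sub>R speed))\<^sup>2) =
        E n (?h u) (\<lambda>l. (norm (?Z l))\<^sup>2) + 2 * inner a (E n (?h u) ?Z) + (norm a)\<^sup>2"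
      unfolding shift square
      by (simp only: mean_add mean_cmult mean_const
          mean_linear[OF bounded_linear.linear[OF bounded_linear_inner_right]])
    then have "E n (?h u) (\<lambda>l. (norm (\<iota> (hd l) - \<iota> (hd h) - real (Suc n) *\<^sub>R speed))\<^sup>2) =
        spread n (?h u) + 2 * inner a (E n (?h u) ?Z) + (norm a)\<^sup>2"
      by (simp add: spread_def)
    moreover have "E n (?h u) ?Z = (\<Sum>m<n. velocity m (?h u) - speed)"
      by (simp add: mean_diff mean_const mean_position sum_subtractf sum_constant_scaleR)
    then have "norm (E n (?h u) ?Z) \<le> velocity_error n (?h u)"
      unfolding velocity_error_def by (simp add: norm_sum)
    then have "inner a (E n (?h u) ?Z) \<le> 2 * velocity_error n (?h u)"
      using a norm_cauchy_schwarz[of a "E n (?h u) ?Z"]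
        mult_mono[of "norm a" 2 "norm (E n (?h u) ?Z)" "velocity_error n (?h u)"] by simp
    moreover have "(norm a)\<^sup>2 \<le> 4"
      using power_mono[OF a, of 2] by simp
    ultimately show ?thesis by linarith
  qed
  have "spread (Suc n) h \<le> (\<Sum>u\<in>U. K h u * (4 + 4 * velocity_error n (?h u) + spread n (?h u)))"
    unfolding spread_def[of "Suc n"] path_mean.simps real_scaleR_def
    by (intro sum_mono mult_left_mono step kernel_nonneg)
  also have "\<dots> = (\<Sum>u\<in>U. K h u) * 4 + 4 * (\<Sum>u\<in>U. K h u * velocity_error n (?h u)) +
      (\<Sum>u\<in>U. K h u * spread n (?h u))"
    unfolding sum_distrib_left sum_distrib_right sum.distrib[symmetric]
    by (intro sum.cong refl) (simp add: algebra_simps)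
  finally show ?thesis by (simp add: kernel_total)
qed

lemma velocity_error_mono: "n \<le> n' \<Longrightarrow> velocity_error n h \<le> velocity_error n' h"
  unfolding velocity_error_def by (intro sum_mono2) auto

lemma spread_le: "spread n h \<le> (\<Sum>i<n. 4 + 4 * E (Suc i) h (velocity_error n))"
proof (induction n arbitrary: h)
  case 0
  then show ?case by (simp add: spread_def)
next
  case (Suc n)
  let ?h = "\<lambda>u. (hd h + u) # h"
  have mono: "E i l (velocity_error n) \<le> E i l (velocity_error (Suc n))" for i l
    by (intro mean_mono velocity_error_mono) simp
  have "spread n (?h u) \<le> (\<Sum>i<n. 4 + 4 * E (Suc i) (?h u) (velocity_error (Suc n)))" for u
    by (rule order_trans[OF Suc.IH]) (intro sum_mono add_left_mono mult_left_mono mono, simp)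
  then have "(\<Sum>u\<in>U. K h u * spread n (?h u)) \<le>
      (\<Sum>u\<in>U. K h u * (\<Sum>i<n. 4 + 4 * E (Suc i) (?h u) (velocity_error (Suc n))))"
    by (intro sum_mono mult_left_mono kernel_nonneg)
  also have "\<dots> = (\<Sum>i<n. 4 + 4 * E (Suc (Suc i)) h (velocity_error (Suc n)))"
  proof -
    have "(\<Sum>u\<in>U. K h u * (4 + 4 * E (Suc i) (?h u) (velocity_error (Suc n)))) =
        4 + 4 * E (Suc (Suc i)) h (velocity_error (Suc n))" for i
    proof -
      have "(\<Sum>u\<in>U. K h u * (4 + 4 * E (Suc i) (?h u) (velocity_error (Suc n)))) =
          (\<Sum>u\<in>U. K h u) * 4 + 4 * (\<Sum>u\<in>U. K h u * E (Suc i) (?h u) (velocity_error (Suc n)))"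
        unfolding sum_distrib_left sum_distrib_right sum.distrib[symmetric]
        by (intro sum.cong refl) (simp only: distrib_left mult.left_commute)
      also have "(\<Sum>u\<in>U. K h u * E (Suc i) (?h u) (velocity_error (Suc n))) =
          E (Suc (Suc i)) h (velocity_error (Suc n))"
        by (simp only: path_mean.simps(2)[where n = "Suc i"] real_scaleR_def)
      finally show ?thesis by (simp only: kernel_total mult_1)
    qed
    then show ?thesis unfolding sum_distrib_left by (subst sum.swap) (simp flip: sum_distrib_left)
  qed
  finally have "spread (Suc n) h \<le> (4 + 4 * E (Suc 0) h (velocity_error (Suc n))) +
      (\<Sum>i<n. 4 + 4 * E (Suc (Suc i)) h (velocity_error (Suc n)))"
    using spread_Suc_le[of n h] mono[of 1 h] by simp
  then show ?case by (simp only: sum.lessThan_Suc_shift)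
qed

text \<open>
  At time \<open>i\<close> the site \<open>l ! Suc t\<close> was left \<open>t + 1\<close> steps ago. Seen from that moment, a visit at time
  \<open>i + j\<close> is a return after \<open>t + 1 + j\<close> steps, and
  \<open>(t + 1) (j + 1) \<le> (t + j + 2) min (t + j + 2) n\<close>, valid for \<open>t < n\<close>, lets the Green function bound gain the factor
  \<open>t + 1\<close>.
\<close>

lemma mean_visits_to_past_le:
  assumes "t < i" "i \<le> n"
  shows "E i [0] (\<lambda>l. \<Sum>j<n. real (j + 1) * E j l (\<lambda>l'. of_bool (hd l' = l ! Suc t)))
    \<le> \<Gamma> n / real (t + 1)"
proof -
  have inner: "E (t + 1) h (\<lambda>l. \<Sum>j<n. real (j + 1) * E j l (\<lambda>l'. of_bool (hd l' = l ! Suc t)))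
      \<le> \<Gamma> n / real (t + 1)" if h: "h \<noteq> []" for h
  proof -
    let ?p = "\<lambda>j. visit (t + 1 + j) h (hd h)"
    have "E (t + 1) h (\<lambda>l. \<Sum>j<n. real (j + 1) * E j l (\<lambda>l'. of_bool (hd l' = l ! Suc t))) =
        E (t + 1) h (\<lambda>l. \<Sum>j<n. real (j + 1) * visit j l (hd h))"
    proof (rule mean_cong)
      fix l assume "length l = t + 1 + length h" "drop (t + 1) l = h"
      then have "l ! Suc t = hd h" using h hd_drop_conv_nth[of "Suc t" l] by auto
      then show "(\<Sum>j<n. real (j + 1) * E j l (\<lambda>l'. of_bool (hd l' = l ! Suc t))) =
          (\<Sum>j<n. real (j + 1) * visit j l (hd h))" by simp
    qed
    also have "\<dots> = (\<Sum>j<n. real (j + 1) * ?p j)"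
      by (simp only: mean_sum mean_cmult mean_tower)
    finally have eq: "E (t + 1) h (\<lambda>l. \<Sum>j<n. real (j + 1) * E j l (\<lambda>l'. of_bool (hd l' = l ! Suc t))) =
        (\<Sum>j<n. real (j + 1) * ?p j)" .
    have "real (t + 1) * (\<Sum>j<n. real (j + 1) * ?p j) \<le>
        (\<Sum>j<n. real (t + 1 + j + 1) * weight n (t + 1 + j) * ?p j)"
      unfolding sum_distrib_left
    proof (rule sum_mono)
      fix j
      have "real (t + 1) * real (j + 1) \<le> weight n (t + 1 + j) * real (t + 1 + j + 1)"
        using assms by (intro mult_mono) (auto simp: weight_def)
      then have "real (t + 1) * real (j + 1) * ?p j \<le> weight n (t + 1 + j) * real (t + 1 + j + 1) * ?p j"
        by (rule mult_right_mono[OF _ mean_nonneg]) simp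
      then show "real (t + 1) * (real (j + 1) * ?p j) \<le>
          real (t + 1 + j + 1) * weight n (t + 1 + j) * ?p j"
        by (simp only: mult.assoc mult.commute mult.left_commute)
    qed
    also have "\<dots> = (\<Sum>j\<in>{t + 1..<t + 1 + n}. real (j + 1) * weight n j * visit j h (hd h))"
      by (rule sum.reindex_bij_witness[of _ "\<lambda>j. j - (t + 1)" "\<lambda>j. t + 1 + j"]) auto
    also have "\<dots> \<le> (\<Sum>j<t + 1 + n. real (j + 1) * weight n j * visit j h (hd h))"
      by (intro sum_mono2) (auto intro!: mult_nonneg_nonneg weight_nonneg mean_nonneg)
    also have "\<dots> \<le> \<Gamma> n" by (rule weighted_visits_le[OF h])
    finally show ?thesis unfolding eq by (simp add: pos_le_divide_eq mult.commute)
  qed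
  have i: "i = (i - (t + 1)) + (t + 1)" using assms by simp
  have "E i [0] (\<lambda>l. \<Sum>j<n. real (j + 1) * E j l (\<lambda>l'. of_bool (hd l' = l ! Suc t))) =
      E (i - (t + 1)) [0] (\<lambda>h. E (t + 1) h (\<lambda>l. \<Sum>j<n. real (j + 1) * E j l (\<lambda>l'. of_bool (hd l' = l ! Suc t))))"
    by (subst i, subst mean_tower) (rule refl)
  also have "\<dots> \<le> E (i - (t + 1)) [0] (\<lambda>h. \<Gamma> n / real (t + 1))"
    by (rule mean_mono, rule inner) auto
  finally show ?thesis by (simp add: mean_const)
qed

lemma mean_velocity_error_le:
  assumes "i \<le> n"
  shows "E i [0] (velocity_error n) \<le> 3 * \<kappa> * \<Gamma> n * (1 + harm n)"
proof -
  have "velocity_error n l \<le>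
      3 * \<kappa> * (\<Sum>t<i. \<Sum>j<n. real (j + 1) * E j l (\<lambda>l'. of_bool (hd l' = l ! Suc t))) + 3 * \<kappa> * \<Gamma> n"
    if len: "length l = i + 1" for l
  proof -
    obtain y g where l: "l = y # g" "length g = i" using len by (cases l) auto
    have "velocity_error n l \<le> (\<Sum>m<n. memory_effect m g y + norm (velocity m [0] - speed))"
      unfolding velocity_error_def memory_effect_def l(1) by (intro sum_mono norm_diff_triangle_le) auto
    also have "\<dots> \<le> 3 * \<kappa> * (\<Sum>j<n. real (j + 1) * revisit j l g) + 3 * \<kappa> * \<Gamma> n"
      unfolding sum.distrib l(1)
      by (intro add_mono memory_effect_sum_le_revisits velocity_error_sum_le)
    also have "(\<Sum>j<n. real (j + 1) * revisit j l g) \<le>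
        (\<Sum>j<n. real (j + 1) * (\<Sum>t<i. E j l (\<lambda>l'. of_bool (hd l' = l ! Suc t))))"
      unfolding mean_sum[symmetric] using of_bool_mem_le_sum[where g = g]
      by (intro sum_mono mult_left_mono mean_mono) (auto simp: l)
    also have "\<dots> = (\<Sum>t<i. \<Sum>j<n. real (j + 1) * E j l (\<lambda>l'. of_bool (hd l' = l ! Suc t)))"
      unfolding sum_distrib_left by (rule sum.swap)
    finally show ?thesis using kappa_nonneg by (simp add: mult_left_mono)
  qed
  then have "E i [0] (velocity_error n) \<le> E i [0] (\<lambda>l.
      3 * \<kappa> * (\<Sum>t<i. \<Sum>j<n. real (j + 1) * E j l (\<lambda>l'. of_bool (hd l' = l ! Suc t))) + 3 * \<kappa> * \<Gamma> n)"
    by (intro mean_mono) simp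
  also have "\<dots> = 3 * \<kappa> * (\<Sum>t<i. E i [0] (\<lambda>l. \<Sum>j<n. real (j + 1) *
      E j l (\<lambda>l'. of_bool (hd l' = l ! Suc t)))) + 3 * \<kappa> * \<Gamma> n"
    by (simp only: mean_add mean_cmult mean_const mean_sum)
  also have "\<dots> \<le> 3 * \<kappa> * (\<Sum>t<i. \<Gamma> n / real (t + 1)) + 3 * \<kappa> * \<Gamma> n"
    using kappa_nonneg assms
    by (intro add_right_mono mult_left_mono sum_mono mean_visits_to_past_le) auto
  also have "\<dots> \<le> 3 * \<kappa> * (\<Sum>t<n. \<Gamma> n / real (t + 1)) + 3 * \<kappa> * \<Gamma> n"
    using kappa_nonneg assms
    by (intro add_right_mono mult_left_mono sum_mono2) (auto simp: green_nonneg)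
  also have "(\<Sum>t<n. \<Gamma> n / real (t + 1)) = \<Gamma> n * harm n"
  proof -
    have "(harm n :: real) = (\<Sum>t<n. inverse (real (t + 1)))"
      unfolding harm_def by (rule sum.reindex_bij_witness[of _ Suc "\<lambda>t. t - 1"]) auto
    then show ?thesis by (simp add: sum_distrib_left divide_inverse)
  qed
  finally show ?thesis by (simp add: algebra_simps)
qed

theorem mean_square_error:
  "E n [0] (\<lambda>l. (norm (\<iota> (hd l) - real n *\<^sub>R speed))\<^sup>2) \<le> real n * (4 + 12 * \<kappa> * \<Gamma> n * (1 + harm n))"
proof -
  have "E n [0] (\<lambda>l. (norm (\<iota> (hd l) - real n *\<^sub>R speed))\<^sup>2) = spread n [0]"
    by (simp add: spread_def step_zero)
  also have "\<dots> \<le> (\<Sum>i<n. 4 + 4 * E (Suc i) [0] (velocity_error n))" by (rule spread_le)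
  also have "\<dots> \<le> (\<Sum>i<n. 4 + 4 * (3 * \<kappa> * \<Gamma> n * (1 + harm n)))"
    by (intro sum_mono add_left_mono mult_left_mono mean_velocity_error_le) auto
  finally show ?thesis by (simp add: mult.assoc)
qed

end

section \<open>Time-weighted Green functions of walks with free coordinates\<close>

definition free_part :: "int ^ ('a::finite + 'b::finite) \<Rightarrow> int ^ 'b" where
  "free_part x = (\<chi> j. x $ Inr j)"

lemma free_part_add: "free_part (x + y) = free_part x + free_part y"
  by (simp add: free_part_def vec_eq_iff)

lemma free_part_axis_Inl: "free_part (axis (Inl i) s) = 0"
  by (simp add: free_part_def vec_eq_iff axis_def)

lemma free_part_axis_Inr: "free_part (axis (Inr j) s) = axis j s"
  by (simp add: free_part_def vec_eq_iff axis_def)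

lemma finite_unit_steps: "finite (unit_steps :: (int ^ 'n::finite) set)"
proof -
  have "unit_steps = (\<lambda>(i, s). axis i s :: int ^ 'n) ` (UNIV \<times> {1, - 1})"
    by (auto simp: unit_steps_def)
  moreover have "finite ((\<lambda>(i, s). axis i s :: int ^ 'n) ` (UNIV \<times> {1, - 1}))"
    by (intro finite_imageI finite_SigmaI) auto
  ultimately show ?thesis by metis
qed

lemma unit_steps_left_subset: "unit_steps_left \<subseteq> unit_steps"
  by (auto simp: unit_steps_left_def unit_steps_def)

lemma sum_free_unit_steps:
  fixes F :: "int ^ ('a::finite + 'b::finite) \<Rightarrow> real"
  shows "sum F (unit_steps - unit_steps_left) =
    (\<Sum>j\<in>UNIV. F (axis (Inr j) 1) + F (axis (Inr j) (- 1)))"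
proof -
  have *: "axis (Inr j) s \<noteq> (axis (Inl i) t :: int ^ ('a + 'b))" if "s \<noteq> 0" for i j and s t :: int
    using that by (auto simp: axis_eq_axis)
  have "unit_steps - unit_steps_left =
      (\<lambda>(j, s). axis (Inr j) s :: int ^ ('a + 'b)) ` (UNIV \<times> {1, - 1})"
  proof (intro equalityI subsetI)
    fix x :: "int ^ ('a + 'b)" assume x: "x \<in> unit_steps - unit_steps_left"
    then obtain i s where i: "x = axis i s" "s \<in> {1, - 1}" by (auto simp: unit_steps_def)
    with x obtain j where "i = Inr j" by (cases i) (auto simp: unit_steps_left_def)
    with i show "x \<in> (\<lambda>(j, s). axis (Inr j) s) ` (UNIV \<times> {1, - 1})" by auto
  qed (auto simp: unit_steps_def unit_steps_left_def *)
  moreover have "inj_on (\<lambda>(j, s). axis (Inr j) s :: int ^ ('a + 'b)) (UNIV \<times> {1, - 1})"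
    by (auto simp: inj_on_def axis_eq_axis)
  ultimately have "sum F (unit_steps - unit_steps_left) =
      (\<Sum>(j, s)\<in>UNIV \<times> {1, - 1}. F (axis (Inr j) s))"
    by (simp add: sum.reindex case_prod_unfold)
  also have "\<dots> = (\<Sum>j\<in>UNIV. \<Sum>s\<in>{1, - 1}. F (axis (Inr j) s))"
    by (rule sum.cartesian_product[symmetric])
  finally show ?thesis by simp
qed

text \<open>
  The weights \<open>(j + 1) min (j + 1) N\<close> of the Green function bound are values of this function.
\<close>

definition clock_weight :: "real \<Rightarrow> real \<Rightarrow> real" where
  "clock_weight N X = min (X\<^sup>2) (N * X)"

lemma clock_weight_nonneg: "0 \<le> N \<Longrightarrow> 0 \<le> X \<Longrightarrow> 0 \<le> clock_weight N X"
  by (simp add: clock_weight_def)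

lemma clock_weight_mono: "0 \<le> N \<Longrightarrow> 0 \<le> X \<Longrightarrow> X \<le> Y \<Longrightarrow>
  clock_weight N X \<le> clock_weight N Y"
  unfolding clock_weight_def by (intro min.mono power_mono mult_left_mono)

text \<open>
  Let time advance by \<open>1\<close> in each step, and let a clock count \<open>2 / \<delta>\<close> for each move still to
  come. Moves happen with probability at least \<open>\<delta>\<close>, so the clock runs down by at least \<open>1\<close> on
  average. For the square this drift has to outweigh the second order term, whence the factor \<open>2\<close>
  and the lower bound for \<open>X\<close>. The inequality holds for \<open>X\<^sup>2\<close> and for \<open>N * X\<close>, and it passes to their
  minimum because an average of minima is at most the minimum of the averages.
\<close>

lemma clock_weight_step:
  assumes \<delta>: "0 < \<delta>" "\<delta> \<le> 1" and N: "0 \<le> N" and X: "2 / \<delta> \<le> X"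
  shows "(1 - \<delta>) * clock_weight N (X + 1) + \<delta> * clock_weight N (X + 1 - 2 / \<delta>) \<le> clock_weight N X"
proof -
  define c where "c = 2 / \<delta>"
  have dc: "\<delta> * c = 2" using \<delta> by (simp add: c_def)
  have bound: "(1 - \<delta>) * clock_weight N (X + 1) + \<delta> * clock_weight N (X + 1 - c) \<le>
      (1 - \<delta>) * F (X + 1) + \<delta> * F (X + 1 - c)"
    if "\<And>Y. clock_weight N Y \<le> F Y" for F :: "real \<Rightarrow> real"
    using \<delta> that by (intro add_mono mult_left_mono) auto
  have "(1 - \<delta>) * (X + 1)\<^sup>2 + \<delta> * (X + 1 - c)\<^sup>2 = (X + 1)\<^sup>2 - 2 * (\<delta> * c) * (X + 1) + (\<delta> * c) * c"
    by (simp add: power2_eq_square algebra_simps)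
  also have "\<dots> \<le> X\<^sup>2"
    using X by (simp add: dc power2_eq_square algebra_simps flip: c_def)
  finally have 1: "(1 - \<delta>) * (X + 1)\<^sup>2 + \<delta> * (X + 1 - c)\<^sup>2 \<le> X\<^sup>2" .
  have "(1 - \<delta>) * (N * (X + 1)) + \<delta> * (N * (X + 1 - c)) = N * (X + 1 - \<delta> * c)"
    by (simp add: algebra_simps)
  also have "\<dots> \<le> N * X" using N by (intro mult_left_mono) (auto simp: dc)
  finally have 2: "(1 - \<delta>) * (N * (X + 1)) + \<delta> * (N * (X + 1 - c)) \<le> N * X" .
  show ?thesis
    unfolding c_def[symmetric] clock_weight_def[of N X]
    using bound[of "\<lambda>Y. Y\<^sup>2"] bound[of "\<lambda>Y. N * Y"] 1 2 by (simp add: clock_weight_def)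
qed

text \<open>
  When no move is left, the walk stays with probability at most \<open>1 - \<delta>\<close>; for \<open>\<delta> X \<ge> 6\<close> half of the
  loss \<open>\<delta>\<close> covers the growth of the weight from \<open>X\<close> to \<open>X + 1\<close> and the other half pays for the
  visit.
\<close>

lemma clock_weight_source:
  assumes \<delta>: "0 < \<delta>" "\<delta> \<le> 1" and N: "0 \<le> N" and X: "6 / \<delta> \<le> X" and Y: "0 \<le> Y" "Y \<le> X"
  shows "(1 - \<delta>) * clock_weight N (X + 1) + \<delta> / 2 * clock_weight N Y \<le> clock_weight N X"
proof -
  have dX: "6 \<le> \<delta> * X" using X \<delta> by (simp add: pos_divide_le_eq mult.commute)
  have "6 \<le> X" using dX \<delta> Y mult_right_mono[of \<delta> 1 X] by linarith
  have bound: "(1 - \<delta>) * clock_weight N (X + 1) + \<delta> / 2 * clock_weight N Y \<le>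
      (1 - \<delta>) * F (X + 1) + \<delta> / 2 * F X"
    if "\<And>Z. clock_weight N Z \<le> F Z" for F :: "real \<Rightarrow> real"
    using \<delta> that clock_weight_mono[OF N Y] order_trans by (intro add_mono mult_left_mono) fastforce+
  have "6 * X \<le> \<delta> * X\<^sup>2"
    using mult_right_mono[OF dX, of X] \<open>6 \<le> X\<close> by (simp add: power2_eq_square mult.assoc)
  moreover have "(1 - \<delta>) * (2 * X + 1) \<le> 1 * (2 * X + 1)"
    using \<delta> \<open>6 \<le> X\<close> by (intro mult_right_mono) auto
  moreover have "(1 - \<delta>) * (X + 1)\<^sup>2 + \<delta> / 2 * X\<^sup>2 = X\<^sup>2 - \<delta> * X\<^sup>2 / 2 + (1 - \<delta>) * (2 * X + 1)"
    by (simp add: power2_eq_square algebra_simps)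
  ultimately have 1: "(1 - \<delta>) * (X + 1)\<^sup>2 + \<delta> / 2 * X\<^sup>2 \<le> X\<^sup>2"
    using \<open>6 \<le> X\<close> by (smt (verit) field_sum_of_halves)
  have "(1 - \<delta>) * (N * (X + 1)) + \<delta> / 2 * (N * X) = N * (X + 1 - \<delta> - \<delta> * X / 2)"
    by (simp add: algebra_simps)
  also have "\<dots> \<le> N * X" using N dX \<delta> by (intro mult_left_mono) auto
  finally have 2: "(1 - \<delta>) * (N * (X + 1)) + \<delta> / 2 * (N * X) \<le> N * X" .
  show ?thesis
    unfolding clock_weight_def[of N X]
    using bound[of "\<lambda>Y. Y\<^sup>2"] bound[of "\<lambda>Y. N * Y"] 1 2 by (simp add: clock_weight_def)
qed

text \<open>
  The coordinates \<open>Inr j\<close> make steps of simple random walk, at a rate that may depend on the whole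
  past but is never below \<open>\<delta>\<close>.
\<close>

locale partially_free_walk = memory_walk unit_steps K
  for K :: "(int ^ ('a::finite + 'b::finite)) list \<Rightarrow> int ^ ('a + 'b) \<Rightarrow> real" +
  fixes \<delta> :: real
  assumes delta_pos: "0 < \<delta>" and delta_le: "\<delta> \<le> 1"
    and bound_left: "(\<Sum>u\<in>unit_steps_left. K h u) \<le> 1 - \<delta>"
    and free_uniform: "v \<in> unit_steps - unit_steps_left \<Longrightarrow>
      K h v = (1 - (\<Sum>u\<in>unit_steps_left. K h u)) / (2 * real CARD('b))"
begin

lemma step_mean_free_part:
  fixes F :: "int ^ 'b \<Rightarrow> real" and h :: "(int ^ ('a + 'b)) list"
  defines "a \<equiv> 1 - (\<Sum>u\<in>unit_steps_left. K h u)"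
  shows "(\<Sum>u\<in>unit_steps. K h u * F (x + free_part u)) =
    (1 - a) * F x + a * ((\<Sum>j\<in>UNIV. F (x + axis j 1) + F (x + axis j (- 1))) / (2 * real CARD('b)))"
proof -
  have free: "axis (Inr j) s \<in> (unit_steps - unit_steps_left :: (int ^ ('a + 'b)) set)"
    if "s \<in> {1, - 1}" for j s
    using that by (auto simp: unit_steps_def unit_steps_left_def axis_eq_axis)
  have "(\<Sum>u\<in>unit_steps. K h u * F (x + free_part u)) =
      (\<Sum>u\<in>unit_steps - unit_steps_left. K h u * F (x + free_part u)) +
      (\<Sum>u\<in>unit_steps_left. K h u * F (x + free_part u))"
    by (rule sum.subset_diff[OF unit_steps_left_subset finite_unit_steps])
  also have "(\<Sum>u\<in>unit_steps_left. K h u * F (x + free_part u)) = (\<Sum>u\<in>unit_steps_left. K h u * F x)"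
    by (rule sum.cong) (auto simp: unit_steps_left_def free_part_axis_Inl)
  also have "\<dots> = (1 - a) * F x" by (simp add: a_def sum_distrib_right)
  also have "(\<Sum>u\<in>unit_steps - unit_steps_left. K h u * F (x + free_part u)) =
      (\<Sum>j\<in>UNIV. a / (2 * real CARD('b)) * (F (x + axis j 1) + F (x + axis j (- 1))))"
    unfolding sum_free_unit_steps
    by (rule sum.cong) (use free in \<open>simp_all add: free_uniform free_part_axis_Inr a_def distrib_left\<close>)
  finally show ?thesis by (simp add: sum_distrib_left sum_divide_distrib)
qed

definition clock :: "nat \<Rightarrow> nat \<Rightarrow> real" where
  "clock j k = real j + real k * (2 / \<delta>) + 6 / \<delta>"

text \<open>
  A bound for the weight collected at a target from time \<open>j\<close> on, while the number of moves of the
  free coordinates since time \<open>j\<close> is exactly \<open>k\<close>, if these moves lead to the target.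
\<close>

definition potential :: "real \<Rightarrow> nat \<Rightarrow> nat \<Rightarrow> real" where
  "potential N j k = 2 / \<delta> * clock_weight N (clock j k)"

lemma clock_ge: "6 / \<delta> \<le> clock j k" "0 \<le> clock j k"
  using delta_pos by (auto simp: clock_def)

lemma potential_source:
  assumes "0 \<le> N" "\<delta> \<le> a"
  shows "(1 - a) * potential N (Suc j) 0 + clock_weight N (real (j + 1)) \<le> potential N j 0"
proof -
  have Y: "real (j + 1) \<le> clock j 0" "0 \<le> real (j + 1)" and suc: "clock (Suc j) 0 = clock j 0 + 1"
    using delta_pos delta_le by (simp_all add: clock_def pos_le_divide_eq)
  have "(1 - a) * potential N (Suc j) 0 \<le> (1 - \<delta>) * potential N (Suc j) 0"
    using assms delta_pos clock_ge
    by (intro mult_right_mono) (auto simp: potential_def clock_weight_nonneg)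
  moreover have "2 / \<delta> * ((1 - \<delta>) * clock_weight N (clock j 0 + 1) + \<delta> / 2 * clock_weight N (real (j + 1)))
      \<le> 2 / \<delta> * clock_weight N (clock j 0)"
    using delta_pos delta_le assms Y clock_ge
    by (intro mult_left_mono clock_weight_source) auto
  moreover have "2 / \<delta> * ((1 - \<delta>) * clock_weight N (clock j 0 + 1) + \<delta> / 2 * clock_weight N (real (j + 1))) =
      (1 - \<delta>) * potential N (Suc j) 0 + clock_weight N (real (j + 1))"
    using delta_pos by (simp add: potential_def suc distrib_left mult.left_commute)
  ultimately show ?thesis unfolding potential_def[of N j 0] by linarith
qed

lemma potential_step:
  assumes N: "0 \<le> N" and a: "\<delta> \<le> a"
  shows "(1 - a) * potential N (Suc j) (Suc k) + a * potential N (Suc j) k \<le> potential N j (Suc k)"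
proof -
  have c: "clock (Suc j) (Suc k) = clock j (Suc k) + 1" "clock (Suc j) k = clock j (Suc k) + 1 - 2 / \<delta>"
    by (auto simp: clock_def algebra_simps add_divide_distrib)
  have "2 / \<delta> \<le> clock j (Suc k)"
  proof -
    have "0 \<le> real k * (2 / \<delta>)" "0 \<le> 6 / \<delta>" using delta_pos by simp_all
    then show ?thesis unfolding clock_def of_nat_Suc distrib_right by linarith
  qed
  then have "2 / \<delta> * ((1 - \<delta>) * clock_weight N (clock j (Suc k) + 1) +
      \<delta> * clock_weight N (clock j (Suc k) + 1 - 2 / \<delta>)) \<le> 2 / \<delta> * clock_weight N (clock j (Suc k))"
    using delta_pos delta_le N by (intro mult_left_mono clock_weight_step) auto
  then have base: "(1 - \<delta>) * potential N (Suc j) (Suc k) + \<delta> * potential N (Suc j) k \<le> potential N j (Suc k)"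
    unfolding potential_def c by (simp only: distrib_left mult.left_commute)
  have "potential N (Suc j) k \<le> potential N (Suc j) (Suc k)"
    unfolding potential_def using delta_pos N clock_ge
    by (intro mult_left_mono clock_weight_mono) (auto simp: clock_def intro!: divide_right_mono)
  then have "(a - \<delta>) * potential N (Suc j) k \<le> (a - \<delta>) * potential N (Suc j) (Suc k)"
    using a by (intro mult_left_mono) auto
  with base show ?thesis by (simp add: algebra_simps)
qed

lemma potential_nonneg: "0 \<le> N \<Longrightarrow> 0 \<le> potential N j k"
  unfolding potential_def using delta_pos clock_ge by (intro mult_nonneg_nonneg clock_weight_nonneg) auto

text \<open>
  The free coordinates move with some probability \<open>a \<ge> \<delta>\<close> depending on the past. A move turns
  \<open>heat_kernel k\<close> into \<open>heat_kernel (k + 1)\<close>, and the claim reduces to inequalities between the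
  coefficients that hold for all such \<open>a\<close> at once. This is why the dependence of the rate on the
  past does no harm.
\<close>

lemma weighted_visits_le_potential:
  assumes N: "0 \<le> N"
  shows "(\<Sum>i<r. clock_weight N (real (j + i + 1)) * E i h (\<lambda>l. of_bool (free_part (hd l) = y))) \<le>
    (\<Sum>k\<le>r. potential N j k * heat_kernel k (free_part (hd h) - y))"
proof (induction r arbitrary: j h)
  case 0
  then show ?case using N by (auto intro!: mult_nonneg_nonneg potential_nonneg heat_kernel_nonneg)
next
  case (Suc r)
  let ?h = "\<lambda>u. (hd h + u) # h"
  let ?P = "\<lambda>i h. E i h (\<lambda>l. of_bool (free_part (hd l) = y) :: real)"
  define x where "x = free_part (hd h) - y"
  define \<Phi> where "\<Phi> x = (\<Sum>k\<le>r. potential N (Suc j) k * heat_kernel k x)" for x :: "int ^ 'b"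
  define a where "a = 1 - (\<Sum>u\<in>unit_steps_left. K h u)"
  have a: "\<delta> \<le> a" using bound_left[of h] by (simp add: a_def)
  have a1: "a \<le> 1"
    using unit_steps_left_subset kernel_nonneg by (auto simp: a_def intro!: sum_nonneg)
  have "(\<Sum>i<Suc r. clock_weight N (real (j + i + 1)) * ?P i h) =
      clock_weight N (real (j + 1)) * ?P 0 h +
      (\<Sum>i<r. clock_weight N (real (Suc j + i + 1)) * ?P (Suc i) h)"
    by (subst sum.lessThan_Suc_shift) simp
  also have "(\<Sum>i<r. clock_weight N (real (Suc j + i + 1)) * ?P (Suc i) h) =
      (\<Sum>u\<in>unit_steps. K h u * (\<Sum>i<r. clock_weight N (real (Suc j + i + 1)) * ?P i (?h u)))"
    unfolding sum_distrib_left
    by (subst sum.swap) (simp add: sum_distrib_left mult.left_commute)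
  also have "\<dots> \<le> (\<Sum>u\<in>unit_steps. K h u * \<Phi> (x + free_part u))"
  proof (intro sum_mono mult_left_mono kernel_nonneg)
    fix u
    have "free_part (hd (?h u)) - y = x + free_part u"
      by (simp add: x_def free_part_add)
    then show "(\<Sum>i<r. clock_weight N (real (Suc j + i + 1)) * ?P i (?h u)) \<le> \<Phi> (x + free_part u)"
      using Suc.IH[of "Suc j" "?h u"] by (simp only: \<Phi>_def)
  qed
  also have "(\<Sum>u\<in>unit_steps. K h u * \<Phi> (x + free_part u)) =
      (1 - a) * \<Phi> x + a * (\<Sum>k\<le>r. potential N (Suc j) k * heat_kernel (Suc k) x)"
  proof -
    have "(\<Sum>i\<in>UNIV. \<Phi> (x + axis i 1) + \<Phi> (x + axis i (- 1))) / (2 * real CARD('b)) =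
        (\<Sum>k\<le>r. potential N (Suc j) k * heat_kernel (Suc k) x)"
      unfolding \<Phi>_def heat_kernel_Suc sum.distrib[symmetric] distrib_left[symmetric]
      by (subst sum.swap) (simp add: sum_distrib_left sum_divide_distrib)
    then show ?thesis unfolding step_mean_free_part a_def[symmetric] by simp
  qed
  also have "(1 - a) * \<Phi> x \<le> (1 - a) * (\<Sum>k\<le>Suc r. potential N (Suc j) k * heat_kernel k x)"
    unfolding \<Phi>_def using a1 N
    by (intro mult_left_mono) (auto intro!: mult_nonneg_nonneg potential_nonneg heat_kernel_nonneg)
  also have "?P 0 h = heat_kernel 0 x"
    by (simp add: heat_kernel_0 x_def)
  also have "clock_weight N (real (j + 1)) * heat_kernel 0 x +
      ((1 - a) * (\<Sum>k\<le>Suc r. potential N (Suc j) k * heat_kernel k x) +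
        a * (\<Sum>k\<le>r. potential N (Suc j) k * heat_kernel (Suc k) x)) =
      ((1 - a) * potential N (Suc j) 0 + clock_weight N (real (j + 1))) * heat_kernel 0 x +
      (\<Sum>k\<le>r. ((1 - a) * potential N (Suc j) (Suc k) + a * potential N (Suc j) k) * heat_kernel (Suc k) x)"
    by (subst sum.atMost_Suc_shift) (simp add: distrib_left distrib_right sum.distrib sum_distrib_left mult.assoc)
  also have "\<dots> \<le> potential N j 0 * heat_kernel 0 x + (\<Sum>k\<le>r. potential N j (Suc k) * heat_kernel (Suc k) x)"
    using N a by (intro add_mono mult_right_mono sum_mono potential_source potential_step heat_kernel_nonneg)
  also have "\<dots> = (\<Sum>k\<le>Suc r. potential N j k * heat_kernel k x)"
    by (rule sum.atMost_Suc_shift[symmetric])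
  finally show ?case by (simp add: x_def)
qed

end

lemma sum_powr_minus_le_harm:
  assumes "0 \<le> s" "s \<le> 1"
  shows "(\<Sum>k<N. real (k + 1) powr (- s)) \<le> real N powr (1 - s) * harm N"
proof -
  have "(\<Sum>k<N. real (k + 1) powr (- s)) \<le> (\<Sum>k<N. real N powr (1 - s) * inverse (real (k + 1)))"
  proof (rule sum_mono)
    fix k assume k: "k \<in> {..<N}"
    have "real (k + 1) powr (- s) = real (k + 1) powr (1 - s) * real (k + 1) powr (- 1)"
      by (subst powr_add[symmetric]) simp
    also have "\<dots> \<le> real N powr (1 - s) * real (k + 1) powr (- 1)"
      using k assms by (intro mult_right_mono powr_mono2) auto
    finally show "real (k + 1) powr (- s) \<le> real N powr (1 - s) * inverse (real (k + 1))"
      by (simp add: powr_minus)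
  qed
  also have "\<dots> = real N powr (1 - s) * harm N"
    unfolding harm_def sum_distrib_left
    by (rule sum.reindex_bij_witness[of _ "\<lambda>t. t - 1" Suc]) auto
  finally show ?thesis .
qed

text \<open>
  By the mean value theorem the terms are dominated by the increments of \<open>k powr (- s) / s\<close>.
\<close>

lemma sum_powr_tail_le:
  fixes s :: real
  assumes s: "0 < s" and N: "1 \<le> N"
  shows "(\<Sum>k=N..<M. real (k + 1) powr (- 1 - s)) \<le> real N powr (- s) / s"
proof -
  have step: "real (k + 1) powr (- 1 - s) \<le> (real k powr (- s) - real (k + 1) powr (- s)) / s"
    if k: "N \<le> k" for k
  proof -
    obtain z where z: "real k < z" "z < real k + 1"
      "(real k + 1) powr (- s) - real k powr (- s) = (real k + 1 - real k) * (- s * z powr (- s - 1))"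
      using MVT2[of "real k" "real k + 1" "\<lambda>z. z powr (- s)" "\<lambda>z. - s * z powr (- s - 1)"] k N
      by (force intro!: derivative_eq_intros)
    have "(real k + 1) powr (- s - 1) \<le> z powr (- s - 1)"
      using z k N s by (intro powr_mono2') auto
    then have "s * (real k + 1) powr (- s - 1) \<le> s * z powr (- s - 1)"
      using s by (intro mult_left_mono) auto
    also have "\<dots> = real k powr (- s) - (real k + 1) powr (- s)" using z(3) by simp
    finally have "s * (real k + 1) powr (- s - 1) \<le> real k powr (- s) - (real k + 1) powr (- s)" .
    then show ?thesis using s by (simp add: pos_le_divide_eq mult.commute add.commute minus_diff_commute[of 1 s])
  qed
  have "(\<Sum>k=N..<M. real (k + 1) powr (- 1 - s)) \<le>
      (\<Sum>k=N..<M. (real k powr (- s) - real (k + 1) powr (- s)) / s)"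
    by (intro sum_mono step) auto
  also have "\<dots> = (\<Sum>k=N..<M. real k powr (- s) - real (Suc k) powr (- s)) / s"
    by (simp add: sum_divide_distrib)
  also have "\<dots> \<le> real N powr (- s) / s"
  proof (cases "N \<le> M")
    case True
    then have "(\<Sum>k=N..<M. real k powr (- s) - real (Suc k) powr (- s)) = real N powr (- s) - real M powr (- s)"
      by (induction M rule: dec_induct) simp_all
    then show ?thesis using s by (intro divide_right_mono) auto
  qed (use s in simp)
  finally show ?thesis .
qed

lemma sum_min_powr_le:
  assumes s: "1/2 \<le> s" "s \<le> 1"
  shows "(\<Sum>k<M. min (real (k + 1) ^ 2) (real N * real (k + 1)) * real (k + 1) powr (- 2 - s)) \<le>
    3 * (real N powr (1 - s) * harm N)"
proof (cases "N = 0")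
  case True
  then show ?thesis by (simp add: harm_def)
next
  case False
  let ?f = "\<lambda>k. min (real (k + 1) ^ 2) (real N * real (k + 1)) * real (k + 1) powr (- 2 - s)"
  have 1: "?f k \<le> real (k + 1) powr (- s)" for k
  proof -
    have "?f k \<le> real (k + 1) powr 2 * real (k + 1) powr (- 2 - s)"
      by (intro mult_right_mono) (auto simp: powr_numeral)
    also have "\<dots> = real (k + 1) powr (- s)" by (subst powr_add[symmetric]) simp
    finally show ?thesis .
  qed
  have 2: "?f k \<le> real N * real (k + 1) powr (- 1 - s)" for k
  proof -
    have "?f k \<le> real N * real (k + 1) powr 1 * real (k + 1) powr (- 2 - s)"
      by (intro mult_right_mono) auto
    also have "\<dots> = real N * real (k + 1) powr (- 1 - s)"
      by (subst mult.assoc, subst powr_add[symmetric]) simp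
    finally show ?thesis .
  qed
  have "sum ?f {..<M} \<le> sum ?f ({..<N} \<union> {N..<M})"
    by (intro sum_mono2) auto
  also have "\<dots> = sum ?f {..<N} + sum ?f {N..<M}"
    by (intro sum.union_disjoint) auto
  also have "\<dots> \<le> (\<Sum>k<N. real (k + 1) powr (- s)) + real N * (\<Sum>k=N..<M. real (k + 1) powr (- 1 - s))"
    unfolding sum_distrib_left by (intro add_mono sum_mono 1 2)
  also have "\<dots> \<le> real N powr (1 - s) * harm N + real N * (real N powr (- s) / s)"
    using s False by (intro add_mono mult_left_mono sum_powr_minus_le_harm sum_powr_tail_le) auto
  also have "real N * (real N powr (- s) / s) = real N powr (1 - s) / s"
    using False by (simp add: powr_diff powr_minus divide_inverse)
  also have "\<dots> \<le> real N powr (1 - s) * (2 * harm N)"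
  proof -
    have "(harm 1 :: real) \<le> harm N" using False by (intro harm_mono) auto
    then have "1 \<le> (harm N :: real)" by (simp add: harm_expand)
    moreover have "1 / s \<le> 2" using s by (simp add: pos_divide_le_eq)
    ultimately have "1 / s \<le> 2 * harm N" by linarith
    then show ?thesis using mult_left_mono[of "1 / s" "2 * harm N" "real N powr (1 - s)"] by simp
  qed
  finally show ?thesis by (simp add: mult.commute)
qed

definition green_constant :: "real \<Rightarrow> real \<Rightarrow> real \<Rightarrow> real" where
  "green_constant \<delta> s d = 216 / \<delta> ^ 3 * (2 powr (- s - 3) / d) powr (- 2 - s)"

context partially_free_walk
begin

theorem green_bound_lattice:
  assumes s: "1/2 \<le> s" "s \<le> 1" "2 + s \<le> real CARD('b) / 2"
  shows "(\<Sum>j<M. real (j + 1) * real (min (j + 1) N) * E j h (\<lambda>l. of_bool (hd l = z))) \<le>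
    green_constant \<delta> s (real CARD('b)) * (real N powr (1 - s) * harm N)"
proof -
  define C where "C = (2 powr (- s - 3) / real CARD('b)) powr (- 2 - s)"
  let ?m = "\<lambda>k. min (real (k + 1) ^ 2) (real N * real (k + 1))"
  have clk: "real (j + 1) * real (min (j + 1) N) = clock_weight (real N) (real (0 + j + 1))" for j
    by (simp add: clock_weight_def of_nat_min min_mult_distrib_left power2_eq_square mult.commute)
  have pot: "potential (real N) 0 k \<le> 72 / \<delta> ^ 3 * ?m k" for k
  proof -
    have X: "clock 0 k \<le> 6 / \<delta> * real (k + 1)" 
      using delta_pos by (simp add: clock_def field_simps)
    have one: "1 \<le> 6 / \<delta>" using delta_pos delta_le by (simp add: field_simps)
    have "clock_weight (real N) (clock 0 k) \<le> clock_weight (real N) (6 / \<delta> * real (k + 1))"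
      using X clock_ge by (intro clock_weight_mono) auto
    also have "\<dots> \<le> (6 / \<delta>)\<^sup>2 * ?m k"
    proof -
      have "6 / \<delta> \<le> (6 / \<delta>)\<^sup>2" using one by (intro self_le_power) auto
      then have "real N * (6 / \<delta> * real (k + 1)) \<le> (6 / \<delta>)\<^sup>2 * (real N * real (k + 1))"
        using mult_right_mono[of "6 / \<delta>" "(6 / \<delta>)\<^sup>2" "real N * real (k + 1)"]
        by (simp only: mult.left_commute of_nat_0_le_iff zero_le_mult_iff) blast
      then show ?thesis
        unfolding clock_weight_def power_mult_distrib by (auto simp: min_def)
    qed
    finally have "potential (real N) 0 k \<le> 2 / \<delta> * ((6 / \<delta>)\<^sup>2 * ?m k)"
      unfolding potential_def using delta_pos by (intro mult_left_mono) auto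
    also have "\<dots> = 72 / \<delta> ^ 3 * ?m k"
      using delta_pos by (simp add: power2_eq_square power3_eq_cube)
    finally show ?thesis .
  qed
  have hk: "heat_kernel k x \<le> C * real (k + 1) powr (- 2 - s)" for k and x :: "int ^ 'b"
    using heat_kernel_le[of "2 + s" k x] s by (simp add: C_def algebra_simps minus_diff_commute[of 2 s])
  have "(\<Sum>j<M. real (j + 1) * real (min (j + 1) N) * E j h (\<lambda>l. of_bool (hd l = z))) \<le>
      (\<Sum>j<M. clock_weight (real N) (real (0 + j + 1)) * E j h (\<lambda>l. of_bool (free_part (hd l) = free_part z)))"
    unfolding clk by (intro sum_mono mult_left_mono mean_mono clock_weight_nonneg) auto
  also have "\<dots> \<le> (\<Sum>k\<le>M. potential (real N) 0 k * heat_kernel k (free_part (hd h) - free_part z))"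
    by (rule weighted_visits_le_potential) simp
  also have "\<dots> \<le> (\<Sum>k\<le>M. (72 / \<delta> ^ 3 * ?m k) * (C * real (k + 1) powr (- 2 - s)))"
    using delta_pos by (intro sum_mono mult_mono pot hk heat_kernel_nonneg) auto
  also have "\<dots> = 72 / \<delta> ^ 3 * C * (\<Sum>k<Suc M. ?m k * real (k + 1) powr (- 2 - s))"
    by (simp add: sum_distrib_left lessThan_Suc_atMost ac_simps)
  also have "\<dots> \<le> 72 / \<delta> ^ 3 * C * (3 * (real N powr (1 - s) * harm N))"
    using delta_pos s by (intro mult_left_mono sum_min_powr_le) (auto simp: C_def)
  finally show ?thesis by (simp add: green_constant_def C_def)
qed

end

section \<open>The annealed walk as a walk with memory\<close>

fun departures :: "'x::minus \<Rightarrow> 'x list \<Rightarrow> 'x list" where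
  "departures z (y # x # h) =
     (if x = z then (y - x) # departures z (x # h) else departures z (x # h))"
| "departures z _ = []"

lemma departures_notin: "z \<notin> set (tl h) \<Longrightarrow> departures z h = []"
  by (induction z h rule: departures.induct) auto

text \<open>
  Besides the departures recorded in \<open>h\<close> and in \<open>g\<close> there is the one from \<open>hd g\<close> to \<open>last h\<close>, which
  does not start at \<open>z\<close> either.
\<close>

lemma departures_append: "z \<notin> set g \<Longrightarrow> h \<noteq> [] \<Longrightarrow> departures z (h @ g) = departures z h"
proof (induction z h rule: departures.induct)
  case ("2_2" z x)
  then show ?case using departures_notin[of z "x # g"] by simp
qed (auto simp: departures_notin)

lemma departures_translate:
  fixes z :: "'x::ab_group_add"
  shows "departures (z + x) (map ((+) z) h) = departures x h"
  by (induction x h rule: departures.induct) auto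

definition moment :: "(int ^ 'n::finite) measure measure \<Rightarrow> (int ^ 'n) list \<Rightarrow> real" where
  "moment \<mu> L = (\<integral>W. (\<Prod>u\<leftarrow>L. measure W {u}) \<partial>\<mu>)"

text \<open>
  The conditional law of the next step. A history with \<open>moment \<mu> L = 0\<close> has probability zero; the
  law of the first step is assigned to it, so that the kernel is a mixture of the possible laws \<open>W\<close>
  after every history and inherits their properties.
\<close>

definition annealed_kernel ::
  "(int ^ 'n::finite) measure measure \<Rightarrow> (int ^ 'n) list \<Rightarrow> int ^ 'n \<Rightarrow> real" where
  "annealed_kernel \<mu> h u = (let L = departures (hd h) h in
     if moment \<mu> L = 0 then moment \<mu> [u] else moment \<mu> (u # L) / moment \<mu> L)"

fun path_weight :: "(int ^ 'n::finite \<Rightarrow> (int ^ 'n) measure) \<Rightarrow> (int ^ 'n) list \<Rightarrow> real" where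
  "path_weight W (y # x # h) = measure (W x) {y - x} * path_weight W (x # h)"
| "path_weight W _ = 1"

text \<open>
  Sorting the steps of a path by the site at which they start separates the independent factors.
\<close>

lemma path_weight_eq_prod:
  assumes "finite F" "set h \<subseteq> F"
  shows "path_weight W h = (\<Prod>z\<in>F. \<Prod>u\<leftarrow>departures z h. measure (W z) {u})"
  using assms(2)
proof (induction W h rule: path_weight.induct)
  case (1 W y x h)
  have "(\<Prod>z\<in>F. \<Prod>u\<leftarrow>departures z (y # x # h). measure (W z) {u}) =
      (\<Prod>u\<leftarrow>departures x (y # x # h). measure (W x) {u}) *
      (\<Prod>z\<in>F - {x}. \<Prod>u\<leftarrow>departures z (y # x # h). measure (W z) {u})"
    using 1 assms(1) by (intro prod.remove) auto
  also have "\<dots> = measure (W x) {y - x} * ((\<Prod>u\<leftarrow>departures x (x # h). measure (W x) {u}) *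
      (\<Prod>z\<in>F - {x}. \<Prod>u\<leftarrow>departures z (x # h). measure (W z) {u}))"
  proof -
    have "(\<Prod>z\<in>F - {x}. \<Prod>u\<leftarrow>departures z (y # x # h). measure (W z) {u}) =
        (\<Prod>z\<in>F - {x}. \<Prod>u\<leftarrow>departures z (x # h). measure (W z) {u})"
      by (rule prod.cong) auto
    then show ?thesis by simp
  qed
  also have "\<dots> = measure (W x) {y - x} * (\<Prod>z\<in>F. \<Prod>u\<leftarrow>departures z (x # h). measure (W z) {u})"
    using 1 assms(1) by (subst prod.remove[of F x]) auto
  finally show ?case using 1 by simp
qed simp_all

primrec history :: "nat \<Rightarrow> (nat \<Rightarrow> 'x) \<Rightarrow> 'x list" where
  "history 0 \<omega> = [\<omega> 0]"
| "history (Suc n) \<omega> = \<omega> (Suc n) # history n \<omega>"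

lemma history_eq_Cons: "\<exists>h. history n \<omega> = \<omega> n # h"
  by (cases n) auto

lemma hd_history: "hd (history n \<omega>) = \<omega> n"
  by (cases n) auto

lemma history_nth_rev: "length l = Suc n \<Longrightarrow> history n (\<lambda>k. rev l ! k) = l"
proof (induction n arbitrary: l)
  case 0
  then show ?case by (cases l) auto
next
  case (Suc n)
  then obtain y l' where l: "l = y # l'" "length l' = Suc n" by (cases l) auto
  have "history n (\<lambda>k. rev l ! k) = history n (\<lambda>k. rev l' ! k)"
  proof -
    have "history m (\<lambda>k. rev l ! k) = history m (\<lambda>k. rev l' ! k)" if "m \<le> n" for m
      using that l by (induction m) (auto simp: nth_append)
    then show ?thesis by simp
  qed
  then show ?case using Suc.IH[OF l(2)] l by (simp add: nth_append)
qed

lemma history_eq_iff: "history n \<omega> = history n x \<longleftrightarrow> \<omega> \<in> cylinder n x"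
  by (induction n) (auto simp: cylinder_def le_Suc_eq)

lemma path_weight_history:
  "path_weight W (history n x) = (\<Prod>k<n. measure (W (x k)) {x (Suc k) - x k})"
proof (induction n)
  case (Suc n)
  obtain h where h: "history n x = x n # h" using history_eq_Cons[of n x] by auto
  then have "path_weight W (history (Suc n) x) = measure (W (x n)) {x (Suc n) - x n} * path_weight W (history n x)"
    by simp
  then show ?case using Suc by simp
qed simp

locale site_law = prob_space \<mu> for \<mu> :: "(int ^ 'n::finite) measure measure" +
  assumes sets_site_law: "sets \<mu> = sets step_laws"
begin

lemma measurable_step_prob: "(\<lambda>W. measure W {u}) \<in> borel_measurable \<mu>"
proof -
  have "(\<lambda>W. measure W {u}) \<in> borel_measurable step_laws"
  proof (cases "u \<in> unit_steps")
    case True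
    then show ?thesis
      unfolding step_laws_def prob_algebra_def
      by (intro measurable_restrict_space1 measurable_measure_subprob_algebra) auto
  next
    case False
    have "measure W {u} = 0" if "W \<in> space step_laws" for W :: "(int ^ 'n) measure"
      using False step_law_sets[of "\<lambda>_. W"] that by (intro measure_notin_sets) auto
    then show ?thesis by (simp cong: measurable_cong)
  qed
  then show ?thesis using sets_site_law by (simp cong: measurable_cong_sets)
qed

lemma in_space_step_laws: "W \<in> space \<mu> \<Longrightarrow> W \<in> space step_laws"
  using sets_eq_imp_space_eq[OF sets_site_law] by simp

lemma step_prob_le_1: "W \<in> space \<mu> \<Longrightarrow> measure W {u} \<le> 1"
  using step_law_prob_space[of "\<lambda>_. W"] in_space_step_laws by (simp add: prob_space.prob_le_1)

lemma step_prob_total: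
  assumes "W \<in> space \<mu>"
  shows "(\<Sum>u\<in>unit_steps. measure W {u}) = 1"
proof -
  note W = in_space_step_laws[OF assms]
  interpret W: prob_space W using step_law_prob_space[of "\<lambda>_. W"] W by simp
  have sets: "sets W = Pow unit_steps" and space: "space W = unit_steps"
    using step_law_sets[of "\<lambda>_. W"] step_law_space[of "\<lambda>_. W"] W by simp_all
  have "W.prob (space W) = (\<Sum>u\<in>space W. W.prob {u})"
    by (intro W.finite_measure_eq_sum_singleton) (auto simp: space sets finite_unit_steps)
  then show ?thesis using W.prob_space by (simp add: space)
qed

lemma step_product_bounds:
  "W \<in> space \<mu> \<Longrightarrow> 0 \<le> (\<Prod>u\<leftarrow>L. measure W {u}) \<and> (\<Prod>u\<leftarrow>L. measure W {u}) \<le> 1"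
  by (induction L) (auto simp: mult_le_one step_prob_le_1)

lemma measurable_step_product: "(\<lambda>W. \<Prod>u\<leftarrow>L. measure W {u}) \<in> borel_measurable \<mu>"
  by (induction L) (simp_all add: measurable_step_prob borel_measurable_times)

lemma integrable_step_product: "integrable \<mu> (\<lambda>W. \<Prod>u\<leftarrow>L. measure W {u})"
  using step_product_bounds
  by (intro integrable_const_bound[where B = 1] measurable_step_product) (auto intro!: AE_I2)

lemma moment_nonneg: "0 \<le> moment \<mu> L"
  unfolding moment_def using step_product_bounds by (intro integral_nonneg_AE AE_I2) auto

lemma moment_Nil: "moment \<mu> [] = 1"
  by (simp add: moment_def prob_space)

lemma moment_Cons_le: "moment \<mu> (u # L) \<le> moment \<mu> L"
  unfolding moment_def using step_product_bounds step_prob_le_1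
  by (intro integral_mono integrable_step_product) (auto intro!: mult_left_le_one_le)

lemma annealed_kernel_eq_ratio:
  obtains L where "0 < moment \<mu> L" "\<And>u. annealed_kernel \<mu> h u = moment \<mu> (u # L) / moment \<mu> L"
proof (cases "moment \<mu> (departures (hd h) h) = 0")
  case True
  then show ?thesis
    by (intro that[of "[]"]) (auto simp: moment_Nil annealed_kernel_def)
next
  case False
  then show ?thesis
    using moment_nonneg[of "departures (hd h) h"]
    by (intro that[of "departures (hd h) h"]) (auto simp: annealed_kernel_def Let_def)
qed

text \<open>
  The kernel is the mean of the \<open>W\<close> under a probability measure that is absolutely continuous
  with respect to \<open>\<mu>\<close>, so linear inequalities that hold for \<open>\<mu>\<close>-almost all \<open>W\<close> carry over.
\<close>

lemma annealed_kernel_mean_le: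
  assumes "finite A" and bound: "AE W in \<mu>. (\<Sum>u\<in>A. c u * measure W {u}) \<le> b"
  shows "(\<Sum>u\<in>A. c u * annealed_kernel \<mu> h u) \<le> b"
proof -
  obtain L where L: "0 < moment \<mu> L" "\<And>u. annealed_kernel \<mu> h u = moment \<mu> (u # L) / moment \<mu> L"
    using annealed_kernel_eq_ratio[where h = h] by blast
  have int: "integrable \<mu> (\<lambda>W. c u * (\<Prod>v\<leftarrow>u # L. measure W {v}))" for u
    by (intro integrable_mult_right integrable_step_product)
  have "(\<Sum>u\<in>A. c u * moment \<mu> (u # L)) = (\<integral>W. (\<Sum>u\<in>A. c u * (\<Prod>v\<leftarrow>u # L. measure W {v})) \<partial>\<mu>)"
    unfolding moment_def using int
    by (subst Bochner_Integration.integral_sum) (auto simp del: prod_list.Cons list.map)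
  also have "\<dots> \<le> (\<integral>W. b * (\<Prod>v\<leftarrow>L. measure W {v}) \<partial>\<mu>)"
  proof (intro integral_mono_AE Bochner_Integration.integrable_sum int integrable_mult_right integrable_step_product)
    show "AE W in \<mu>. (\<Sum>u\<in>A. c u * (\<Prod>v\<leftarrow>u # L. measure W {v})) \<le> b * (\<Prod>v\<leftarrow>L. measure W {v})"
      using bound
    proof eventually_elim
      case (elim W)
      have nn: "0 \<le> (\<Prod>v\<leftarrow>L. measure W {v})" by (induction L) auto
      have "(\<Sum>u\<in>A. c u * (\<Prod>v\<leftarrow>u # L. measure W {v})) =
          (\<Sum>u\<in>A. c u * measure W {u}) * (\<Prod>v\<leftarrow>L. measure W {v})"
        by (simp add: sum_distrib_right mult.assoc)
      then show ?case using mult_right_mono[OF elim nn] by simp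
    qed
  qed
  also have "\<dots> = b * moment \<mu> L" by (simp add: moment_def)
  finally have "(\<Sum>u\<in>A. c u * moment \<mu> (u # L)) \<le> b * moment \<mu> L" .
  then show ?thesis
    using L(1) by (simp add: L(2) pos_divide_le_eq flip: sum_divide_distrib)
qed

lemma annealed_kernel_mean_eq:
  assumes A: "finite A" and eq: "AE W in \<mu>. (\<Sum>u\<in>A. c u * measure W {u}) = b"
  shows "(\<Sum>u\<in>A. c u * annealed_kernel \<mu> h u) = b"
proof (rule antisym)
  show "(\<Sum>u\<in>A. c u * annealed_kernel \<mu> h u) \<le> b"
    by (rule annealed_kernel_mean_le[OF A]) (use eq in auto)
  have "(\<Sum>u\<in>A. - c u * annealed_kernel \<mu> h u) \<le> - b"
    by (rule annealed_kernel_mean_le[OF A]) (use eq in \<open>auto simp: sum_negf\<close>)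
  then show "b \<le> (\<Sum>u\<in>A. c u * annealed_kernel \<mu> h u)" by (simp add: sum_negf)
qed

lemma annealed_kernel_nonneg: "0 \<le> annealed_kernel \<mu> h u"
proof -
  obtain L where "0 < moment \<mu> L" "\<And>u. annealed_kernel \<mu> h u = moment \<mu> (u # L) / moment \<mu> L"
    using annealed_kernel_eq_ratio[where h = h] by blast
  then show ?thesis using moment_nonneg by simp
qed

lemma annealed_kernel_translate: "h \<noteq> [] \<Longrightarrow> annealed_kernel \<mu> (map ((+) z) h) u = annealed_kernel \<mu> h u"
  by (simp add: annealed_kernel_def hd_map departures_translate)

lemma annealed_kernel_local:
  "z \<notin> set g \<Longrightarrow> annealed_kernel \<mu> ((z # h) @ g) u = annealed_kernel \<mu> (z # h) u"
  using departures_append[of z g "z # h"] by (simp add: annealed_kernel_def)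

interpretation env: product_prob_space "\<lambda>_ :: int ^ 'n. \<mu>" UNIV
  by unfold_locales

lemma mean_path_weight:
  assumes F: "finite F" "set h \<subseteq> F"
  shows "(\<integral>W. path_weight W h \<partial>environment_law \<mu>) = (\<Prod>z\<in>F. moment \<mu> (departures z h))"
proof -
  let ?f = "\<lambda>z V. \<Prod>u\<leftarrow>departures z h. measure V {u}"
  have f: "?f z \<in> borel_measurable \<mu>" for z
    by (rule measurable_step_product)
  have "(\<integral>W. path_weight W h \<partial>environment_law \<mu>) =
      (\<integral>W. (\<Prod>z\<in>F. ?f z (restrict W F z)) \<partial>PiM UNIV (\<lambda>_. \<mu>))"
    unfolding environment_law_def
    by (intro Bochner_Integration.integral_cong refl) (simp add: path_weight_eq_prod[OF F])
  also have "\<dots> = (\<integral>V. (\<Prod>z\<in>F. ?f z (V z)) \<partial>distr (PiM UNIV (\<lambda>_. \<mu>)) (PiM F (\<lambda>_. \<mu>)) (\<lambda>W. restrict W F))"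
  proof (rule integral_distr[symmetric])
    show "(\<lambda>W. restrict W F) \<in> PiM UNIV (\<lambda>_. \<mu>) \<rightarrow>\<^sub>M PiM F (\<lambda>_. \<mu>)"
      by (rule measurable_restrict_subset) simp
    show "(\<lambda>V. \<Prod>z\<in>F. ?f z (V z)) \<in> borel_measurable (PiM F (\<lambda>_. \<mu>))"
      by (intro borel_measurable_prod measurable_compose[OF _ f] measurable_component_singleton)
  qed
  also have "distr (PiM UNIV (\<lambda>_. \<mu>)) (PiM F (\<lambda>_. \<mu>)) (\<lambda>W. restrict W F) = PiM F (\<lambda>_. \<mu>)"
    using F by (intro env.distr_PiM_restrict_finite) auto
  also have "(\<integral>V. (\<Prod>z\<in>F. ?f z (V z)) \<partial>PiM F (\<lambda>_. \<mu>)) = (\<Prod>z\<in>F. \<integral>V. ?f z V \<partial>\<mu>)"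
    by (rule env.product_integral_prod[OF F(1)]) (rule integrable_step_product)
  finally show ?thesis by (simp add: moment_def)
qed

text \<open>
  A step from \<open>x\<close> only changes the factor that belongs to the site \<open>x\<close>.
\<close>

lemma mean_path_weight_Cons:
  "(\<integral>W. path_weight W (y # x # h) \<partial>environment_law \<mu>) =
   annealed_kernel \<mu> (x # h) (y - x) * (\<integral>W. path_weight W (x # h) \<partial>environment_law \<mu>)"
proof -
  define F where "F = set (y # x # h)"
  define R where "R = (\<Prod>z\<in>F - {x}. moment \<mu> (departures z (x # h)))"
  let ?L = "departures x (x # h)"
  have "(\<integral>W. path_weight W (y # x # h) \<partial>environment_law \<mu>) =
      (\<Prod>z\<in>F. moment \<mu> (departures z (y # x # h)))"
    by (rule mean_path_weight) (auto simp: F_def)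
  also have "\<dots> = moment \<mu> (departures x (y # x # h)) * (\<Prod>z\<in>F - {x}. moment \<mu> (departures z (y # x # h)))"
    by (rule prod.remove) (auto simp: F_def)
  also have "(\<Prod>z\<in>F - {x}. moment \<mu> (departures z (y # x # h))) = R"
    unfolding R_def by (rule prod.cong) auto
  also have "departures x (y # x # h) = (y - x) # ?L" by simp
  finally have 1: "(\<integral>W. path_weight W (y # x # h) \<partial>environment_law \<mu>) = moment \<mu> ((y - x) # ?L) * R" .
  have "(\<integral>W. path_weight W (x # h) \<partial>environment_law \<mu>) = (\<Prod>z\<in>F. moment \<mu> (departures z (x # h)))"
    by (rule mean_path_weight) (auto simp: F_def)
  also have "\<dots> = moment \<mu> ?L * R"
    unfolding R_def by (rule prod.remove) (auto simp: F_def)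
  finally have 2: "(\<integral>W. path_weight W (x # h) \<partial>environment_law \<mu>) = moment \<mu> ?L * R" .
  show ?thesis
  proof (cases "moment \<mu> ?L = 0")
    case True
    then have "moment \<mu> ((y - x) # ?L) = 0"
      using moment_Cons_le[of "y - x" ?L] moment_nonneg[of "(y - x) # ?L"] by simp
    then show ?thesis unfolding 1 2 True by simp
  next
    case False
    then show ?thesis unfolding 1 2 by (simp add: annealed_kernel_def Let_def)
  qed
qed

lemma measure_annealed_cylinder:
  "measure (annealed_law \<mu>) (cylinder n x) =
   (if x 0 = 0 then \<integral>W. path_weight W (history n x) \<partial>environment_law \<mu> else 0)"
proof -
  have "W z \<in> space step_laws" if "W \<in> space (environment_law \<mu>)" for W z
    using that in_space_step_laws by (auto simp: environment_law_def space_PiM)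
  then have "measure (quenched_law W) (cylinder n x) =
      (if x 0 = 0 then path_weight W (history n x) else 0)" if "W \<in> space (environment_law \<mu>)" for W
    using that by (simp add: measure_quenched_law_cylinder path_weight_history)
  then show ?thesis
    unfolding measure_annealed_law_cylinder[OF prob_space_axioms sets_site_law]
    by (subst Bochner_Integration.integral_cong[OF refl]) auto
qed

definition path_prob :: "nat \<Rightarrow> (int ^ 'n) list \<Rightarrow> real" where
  "path_prob n l = measure (annealed_law \<mu>) {\<omega>. history n \<omega> = l}"

lemma history_event:
  assumes "length l = Suc n"
  shows "{\<omega>. history n \<omega> = l} = cylinder n (\<lambda>k. rev l ! k)"
  using history_eq_iff[of n _ "\<lambda>k. rev l ! k"] history_nth_rev[OF assms] by auto

lemma cylinder_in_sets: "cylinder n x \<in> sets (annealed_law \<mu>)"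
proof -
  have "sets (annealed_law \<mu>) = sets path_space"
    using annealed_law_in_prob_algebra[OF prob_space_axioms sets_site_law] by (simp add: space_prob_algebra)
  then show ?thesis by (auto simp: sets_path_space intro!: sigma_sets.Basic)
qed

lemma path_prob_Suc:
  assumes l: "length l = Suc n"
  shows "path_prob (Suc n) (y # l) = annealed_kernel \<mu> l (y - hd l) * path_prob n l"
proof -
  let ?x = "\<lambda>k. rev (y # l) ! k"
  have hist: "history (Suc n) ?x = y # l" by (rule history_nth_rev) (simp add: l)
  then have xl: "?x (Suc n) = y" "history n ?x = l" by simp_all
  obtain x h where h: "l = x # h" using l by (cases l) auto
  have "{\<omega>. history n \<omega> = l} = cylinder n ?x"
    using history_eq_iff[of n _ ?x] xl(2) by auto
  then have 1: "path_prob n l = (if ?x 0 = 0 then \<integral>W. path_weight W l \<partial>environment_law \<mu> else 0)"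
    using measure_annealed_cylinder[where n = n and x = ?x] by (simp only: path_prob_def xl(2))
  have "{\<omega>. history (Suc n) \<omega> = y # l} = cylinder (Suc n) ?x"
    by (rule history_event) (simp add: l)
  then have 2: "path_prob (Suc n) (y # l) =
      (if ?x 0 = 0 then \<integral>W. path_weight W (y # l) \<partial>environment_law \<mu> else 0)"
    using measure_annealed_cylinder[where n = "Suc n" and x = ?x] by (simp only: path_prob_def hist)
  show ?thesis unfolding 1 2 unfolding h mean_path_weight_Cons by simp
qed

lemma path_prob_0: "path_prob 0 [0] = 1"
proof -
  interpret env_law: prob_space "environment_law \<mu>"
    using environment_law_in_prob_algebra[OF prob_space_axioms sets_site_law] by (simp add: space_prob_algebra)
  have "{\<omega>. history 0 \<omega> = [0 :: int ^ 'n]} = cylinder 0 (\<lambda>_. 0)"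
    by (auto simp: cylinder_def)
  then show ?thesis by (simp add: path_prob_def measure_annealed_cylinder env_law.prob_space)
qed

sublocale memory_walk unit_steps "annealed_kernel \<mu>"
proof
  show fin: "finite (unit_steps :: (int ^ 'n) set)" by (rule finite_unit_steps)
  show "0 \<le> annealed_kernel \<mu> h u" for h u by (rule annealed_kernel_nonneg)
  show "(\<Sum>u\<in>unit_steps. annealed_kernel \<mu> h u) = 1" for h
    using annealed_kernel_mean_eq[OF fin, of "\<lambda>_. 1" 1 h] step_prob_total by auto
qed

primrec reachable :: "nat \<Rightarrow> (int ^ 'n) list set" where
  "reachable 0 = {[0]}"
| "reachable (Suc n) = (\<lambda>(l, u). (hd l + u) # l) ` (reachable n \<times> unit_steps)"

lemma finite_reachable: "finite (reachable n)"
  by (induction n) (auto intro!: finite_imageI finite_steps)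

lemma length_reachable: "l \<in> reachable n \<Longrightarrow> length l = Suc n"
  by (induction n arbitrary: l) auto

lemma path_mean_eq_sum:
  fixes F :: "(int ^ 'n) list \<Rightarrow> 'w::real_vector"
  shows "E n [0] F = (\<Sum>l\<in>reachable n. path_prob n l *\<^sub>R F l)"
proof (induction n arbitrary: F)
  case 0
  then show ?case by (simp add: path_prob_0)
next
  case (Suc n)
  have "E (Suc n) [0] F = (\<Sum>l\<in>reachable n. \<Sum>u\<in>unit_steps.
      path_prob (Suc n) ((hd l + u) # l) *\<^sub>R F ((hd l + u) # l))"
    unfolding mean_Suc_last Suc
    by (intro sum.cong refl) (simp add: path_prob_Suc length_reachable scaleR_right.sum mult.commute)
  also have "\<dots> = (\<Sum>l\<in>reachable (Suc n). path_prob (Suc n) l *\<^sub>R F l)"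
  proof -
    have "inj_on (\<lambda>(l, u). (hd l + u) # l :: (int ^ 'n) list) (reachable n \<times> unit_steps)"
      by (auto simp: inj_on_def)
    then show ?thesis by (simp add: sum.reindex sum.cartesian_product case_prod_unfold)
  qed
  finally show ?case .
qed

text \<open>
  Almost surely the path up to time \<open>n\<close> is one of finitely many, each of them a cylinder event.
\<close>

theorem annealed_mean_eq_path_mean:
  fixes G :: "int ^ 'n \<Rightarrow> 'w::euclidean_space"
  shows "(\<integral>\<omega>. G (\<omega> n) \<partial>annealed_law \<mu>) = E n [0] (\<lambda>l. G (hd l))"
proof -
  have ann: "prob_space (annealed_law \<mu>)" "sets (annealed_law \<mu>) = sets path_space"
    using annealed_law_in_prob_algebra[OF prob_space_axioms sets_site_law] by (simp_all add: space_prob_algebra)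
  interpret P: prob_space "annealed_law \<mu>" by fact
  let ?A = "\<lambda>l. {\<omega>. history n \<omega> = l}"
  have A: "?A l \<in> sets (annealed_law \<mu>)" if "l \<in> reachable n" for l
    using history_event[OF length_reachable[OF that]] cylinder_in_sets by metis
  have full: "AE \<omega> in annealed_law \<mu>. history n \<omega> \<in> reachable n"
  proof -
    have U: "{\<omega>. history n \<omega> \<in> reachable n} = (\<Union>l\<in>reachable n. ?A l)" by auto
    have "P.prob (\<Union>l\<in>reachable n. ?A l) = (\<Sum>l\<in>reachable n. path_prob n l)"
      unfolding path_prob_def using A finite_reachable
      by (intro P.finite_measure_finite_Union) (auto simp: disjoint_family_on_def)
    also have "\<dots> = E n [0] (\<lambda>_. 1 :: real)" by (simp add: path_mean_eq_sum)
    finally have "P.prob {\<omega>. history n \<omega> \<in> reachable n} = 1"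
      unfolding U by (simp add: mean_const)
    moreover have "{\<omega>. history n \<omega> \<in> reachable n} \<in> sets (annealed_law \<mu>)"
      unfolding U using A finite_reachable by (intro sets.finite_UN) auto
    ultimately have "AE \<omega> in annealed_law \<mu>. \<omega> \<in> {\<omega>. history n \<omega> \<in> reachable n}"
      using P.AE_in_set_eq_1 by blast
    then show ?thesis by simp
  qed
  have meas: "(\<lambda>\<omega>. G (\<omega> n)) \<in> borel_measurable (annealed_law \<mu>)"
  proof -
    have "(\<lambda>\<omega>. \<omega> n) \<in> path_space \<rightarrow>\<^sub>M count_space (UNIV :: (int ^ 'n) set)"
      unfolding path_space_def by (rule measurable_component_singleton) simp
    then have "(\<lambda>\<omega>. G (\<omega> n)) \<in> borel_measurable path_space"
      by (rule measurable_compose) simp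
    then show ?thesis using ann(2) by (simp cong: measurable_cong_sets)
  qed
  have "(\<integral>\<omega>. G (\<omega> n) \<partial>annealed_law \<mu>) =
      (\<integral>\<omega>. (\<Sum>l\<in>reachable n. indicator (?A l) \<omega> *\<^sub>R G (hd l)) \<partial>annealed_law \<mu>)"
  proof (rule integral_cong_AE[OF meas])
    show "(\<lambda>\<omega>. \<Sum>l\<in>reachable n. indicator (?A l) \<omega> *\<^sub>R G (hd l)) \<in> borel_measurable (annealed_law \<mu>)"
      using A by (intro borel_measurable_sum borel_measurable_scaleR borel_measurable_indicator) auto
    show "AE \<omega> in annealed_law \<mu>. G (\<omega> n) = (\<Sum>l\<in>reachable n. indicator (?A l) \<omega> *\<^sub>R G (hd l))"
      using full
    proof eventually_elim
      case (elim \<omega>)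
      have "(\<Sum>l\<in>reachable n. indicator (?A l) \<omega> *\<^sub>R G (hd l)) =
          (\<Sum>l\<in>{history n \<omega>}. indicator (?A l) \<omega> *\<^sub>R G (hd l))"
        using elim finite_reachable by (intro sum.mono_neutral_right) (auto simp: indicator_def)
      then show ?case by (simp add: hd_history)
    qed
  qed
  also have "\<dots> = (\<Sum>l\<in>reachable n. path_prob n l *\<^sub>R G (hd l))"
    using A by (subst Bochner_Integration.integral_sum) (auto simp: path_prob_def P.emeasure_eq_measure)
  finally show ?thesis by (simp add: path_mean_eq_sum)
qed

lemma annealed_prob_eq_path_mean:
  "\<P>(\<omega> in annealed_law \<mu>. Q (\<omega> n)) = E n [0] (\<lambda>l. of_bool (Q (hd l)))"
proof -
  have ann: "sets (annealed_law \<mu>) = sets path_space"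
    using annealed_law_in_prob_algebra[OF prob_space_axioms sets_site_law] by (simp_all add: space_prob_algebra)
  have "E n [0] (\<lambda>l. of_bool (Q (hd l)) :: real) = (\<integral>\<omega>. of_bool (Q (\<omega> n)) \<partial>annealed_law \<mu>)"
    by (rule annealed_mean_eq_path_mean[symmetric])
  also have "\<dots> = (\<integral>\<omega>. indicator {\<omega> \<in> space (annealed_law \<mu>). Q (\<omega> n)} \<omega> \<partial>annealed_law \<mu>)"
    by (intro Bochner_Integration.integral_cong) auto
  also have "\<dots> = \<P>(\<omega> in annealed_law \<mu>. Q (\<omega> n))"
    by (simp add: Int_absorb2 subsetI)
  finally show ?thesis by simp
qed

end

section \<open>The law of large numbers\<close>

lemma (in prob_space) AE_of_prob_eq_1:
  assumes "\<P>(x in M. P x) = 1"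
  shows "AE x in M. P x"
proof -
  have "{x \<in> space M. P x} \<in> events"
    using assms measure_notin_sets by fastforce
  then show ?thesis using assms prob_Collect_eq_1 by blast
qed

lemma to_real_vec_add: "to_real_vec (x + y) = to_real_vec x + to_real_vec y"
  by (simp add: to_real_vec_def vec_eq_iff)

lemma norm_to_real_vec_unit_step:
  fixes u :: "int ^ 'n::finite"
  shows "u \<in> unit_steps \<Longrightarrow> norm (to_real_vec u) \<le> 1"
proof -
  have "to_real_vec (axis i s) = real_of_int s *\<^sub>R axis i 1" for i :: 'n and s
    by (simp add: to_real_vec_def vec_eq_iff axis_def)
  then show "u \<in> unit_steps \<Longrightarrow> norm (to_real_vec u) \<le> 1"
    by (auto simp: unit_steps_def norm_axis_1)
qed

lemma green_constant_pos: "0 < \<delta> \<Longrightarrow> 0 < d \<Longrightarrow> 0 < green_constant \<delta> s d"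
  by (simp add: green_constant_def)

text \<open>
  The factor \<open>6\<close> comes from the condition \<open>3 \<kappa> \<Gamma> 1 \<le> 1\<close> for transition probabilities that differ by
  at most \<open>2\<beta>\<close>.
\<close>

locale small_disorder_walk =
  fixes \<mu> :: "(int ^ ('a::finite + 'b::finite)) measure measure" and \<delta> \<beta> s :: real
  assumes partially_random: "partially_random \<delta> \<beta> \<mu>"
    and s: "1/2 \<le> s" "s \<le> 1" "2 + s \<le> real CARD('b) / 2"
    and small_disorder: "6 * real (card (unit_steps :: (int ^ ('a + 'b)) set)) *
      green_constant \<delta> s (real CARD('b)) * \<beta> \<le> 1"

sublocale small_disorder_walk \<subseteq> site_law \<mu>
proof -
  show "site_law \<mu>"
    using partially_random by (auto simp: partially_random_def site_law_def site_law_axioms_def)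
qed

sublocale small_disorder_walk \<subseteq> partially_free_walk "annealed_kernel \<mu>" \<delta>
proof
  have finite_left: "finite (unit_steps_left :: (int ^ ('a + 'b)) set)"
    using unit_steps_left_subset finite_unit_steps by (rule finite_subset)
  show "0 < \<delta>" using partially_random by (simp add: partially_random_def)
  have "AE W in \<mu>. (\<Sum>u\<in>unit_steps_left. measure W {u}) \<le> 1 - \<delta>"
    using partially_random by (intro AE_of_prob_eq_1) (simp add: partially_random_def)
  then show left: "(\<Sum>u\<in>unit_steps_left. annealed_kernel \<mu> h u) \<le> 1 - \<delta>" for h
    using annealed_kernel_mean_le[OF finite_left, of "\<lambda>_. 1" "1 - \<delta>" h] by simp
  have "0 \<le> (\<Sum>u\<in>unit_steps_left. annealed_kernel \<mu> [] u)"
    by (intro sum_nonneg annealed_kernel_nonneg)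
  then show "\<delta> \<le> 1" using left[of "[]"] by simp
  fix v :: "int ^ ('a + 'b)" and h assume v: "v \<in> unit_steps - unit_steps_left"
  define d where "d = 2 * real CARD('b)"
  have "AE W in \<mu>. measure W {v} = (1 - (\<Sum>u\<in>unit_steps_left. measure W {u})) / d"
    using partially_random v unfolding d_def by (intro AE_of_prob_eq_1) (simp add: partially_random_def)
  then have "AE W in \<mu>. (\<Sum>u\<in>insert v unit_steps_left. (if u = v then d else 1) * measure W {u}) = 1"
  proof eventually_elim
    case (elim W)
    have "(\<Sum>u\<in>unit_steps_left. (if u = v then d else 1) * measure W {u}) = (\<Sum>u\<in>unit_steps_left. measure W {u})"
      using v by (intro sum.cong) auto
    then show ?case using v finite_left elim by (simp add: d_def)
  qed
  then have "(\<Sum>u\<in>insert v unit_steps_left. (if u = v then d else 1) * annealed_kernel \<mu> h u) = 1"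
    by (intro annealed_kernel_mean_eq) (use finite_left in simp)
  moreover have "(\<Sum>u\<in>unit_steps_left. (if u = v then d else 1) * annealed_kernel \<mu> h u) =
      (\<Sum>u\<in>unit_steps_left. annealed_kernel \<mu> h u)"
    using v by (intro sum.cong) auto
  ultimately have "d * annealed_kernel \<mu> h v = 1 - (\<Sum>u\<in>unit_steps_left. annealed_kernel \<mu> h u)"
    using v finite_left by simp
  then show "annealed_kernel \<mu> h v = (1 - (\<Sum>u\<in>unit_steps_left. annealed_kernel \<mu> h u)) / (2 * real CARD('b))"
    by (simp add: d_def field_simps)
qed

sublocale small_disorder_walk \<subseteq> local_memory_walk unit_steps "annealed_kernel \<mu>" "2 * \<beta>" to_real_vec
  "\<lambda>N. green_constant \<delta> s (real CARD('b)) * (real N powr (1 - s) * harm N)"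
proof
  show "annealed_kernel \<mu> (map ((+) z) h) u = annealed_kernel \<mu> h u" if "h \<noteq> []" for h z u
    using that by (rule annealed_kernel_translate)
  show "annealed_kernel \<mu> ((z # h) @ g) u = annealed_kernel \<mu> (z # h) u" if "z \<notin> set g" for z h g u
    using that by (rule annealed_kernel_local)
  fix u :: "int ^ ('a + 'b)" assume u: "u \<in> unit_steps"
  show "norm (to_real_vec u) \<le> 1" using u by (rule norm_to_real_vec_unit_step)
  define m where "m = (\<integral>V. measure V {u} \<partial>\<mu>)"
  have ae: "AE W in \<mu>. \<bar>measure W {u} - m\<bar> < \<beta>"
    using partially_random u unfolding m_def by (intro AE_of_prob_eq_1) (simp add: partially_random_def)
  have close: "\<bar>annealed_kernel \<mu> h u - m\<bar> \<le> \<beta>" for h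
  proof -
    have "(\<Sum>v\<in>{u}. 1 * annealed_kernel \<mu> h v) \<le> m + \<beta>"
      using ae by (intro annealed_kernel_mean_le) auto
    moreover have "(\<Sum>v\<in>{u}. - 1 * annealed_kernel \<mu> h v) \<le> \<beta> - m"
      using ae by (intro annealed_kernel_mean_le) auto
    ultimately show ?thesis by simp
  qed
  show "\<bar>annealed_kernel \<mu> h u - annealed_kernel \<mu> h' u\<bar> \<le> 2 * \<beta>" for h h'
    using close[of h] close[of h'] by linarith
next
  show "3 * (2 * \<beta> * real (card (unit_steps :: (int ^ ('a + 'b)) set))) *
      (green_constant \<delta> s (real CARD('b)) * (real 1 powr (1 - s) * harm 1)) \<le> 1"
    using small_disorder by (simp add: harm_expand ac_simps)
qed (use green_bound_lattice[OF s] in \<open>auto simp: to_real_vec_add\<close>)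

lemma harm_le_2_ln: "3 \<le> n \<Longrightarrow> harm n \<le> 2 * ln (real n)"
proof -
  assume n: "3 \<le> n"
  have "exp 1 \<le> (3::real)" by (rule exp_le)
  then have "1 \<le> ln (real n)" using n by (subst ln_ge_iff) auto
  moreover have "harm n \<le> ln (real n) + 1" 
    using euler_mascheroni_sequence_decreasing[of 1 n] n by (simp add: harm_expand)
  ultimately show ?thesis by linarith
qed

context small_disorder_walk
begin

lemma annealed_mean_bigo:
  "(\<lambda>n. norm ((\<integral>\<omega>. to_real_vec (\<omega> n) \<partial>annealed_law \<mu>) - real n *\<^sub>R speed))
    \<in> O(\<lambda>n. real n * (ln (real n) / real n powr s))"
proof (rule bigoI)
  define C where "C = 3 * \<kappa> * green_constant \<delta> s (real CARD('b))"
  have C: "0 \<le> C"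
    unfolding C_def using kappa_nonneg green_constant_pos[OF delta_pos, of "real CARD('b)" s]
    by (intro mult_nonneg_nonneg) auto
  \<comment> \<open>For \<open>n \<ge> 3\<close> one has \<open>ln n \<ge> 1\<close>, and the harmonic sum is at most \<open>2 ln n\<close>.\<close>
  show "\<forall>\<^sub>F n in sequentially. norm (norm ((\<integral>\<omega>. to_real_vec (\<omega> n) \<partial>annealed_law \<mu>) - real n *\<^sub>R speed))
      \<le> 2 * C * norm (real n * (ln (real n) / real n powr s))"
    using eventually_ge_at_top[of 3]
  proof eventually_elim
    case (elim n)
    have "norm ((\<integral>\<omega>. to_real_vec (\<omega> n) \<partial>annealed_law \<mu>) - real n *\<^sub>R speed) \<le>
        C * (real n powr (1 - s) * harm n)"
      using mean_position_error[of n] by (simp add: annealed_mean_eq_path_mean C_def mult.assoc)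
    also have "\<dots> \<le> C * (real n powr (1 - s) * (2 * ln (real n)))"
      using C elim by (intro mult_left_mono harm_le_2_ln) auto
    also have "\<dots> = 2 * C * (real n * (ln (real n) / real n powr s))"
      using elim by (simp add: powr_diff)
    finally show ?case using elim by simp
  qed
qed

text \<open>
  Chebyshev's inequality.
\<close>

lemma deviation_prob_le:
  assumes "0 < \<epsilon>" "0 < n"
  shows "\<P>(\<omega> in annealed_law \<mu>. norm (to_real_vec (\<omega> n) /\<^sub>R real n - speed) > \<epsilon>) \<le>
    (4 + 12 * \<kappa> * (green_constant \<delta> s (real CARD('b)) * (real n powr (1 - s) * harm n)) * (1 + harm n)) /
      (\<epsilon>\<^sup>2 * real n)"
proof -
  let ?Z = "\<lambda>l. norm (to_real_vec (hd l) - real n *\<^sub>R speed)"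
  let ?B = "4 + 12 * \<kappa> * (green_constant \<delta> s (real CARD('b)) * (real n powr (1 - s) * harm n)) * (1 + harm n)"
  have "\<P>(\<omega> in annealed_law \<mu>. norm (to_real_vec (\<omega> n) /\<^sub>R real n - speed) > \<epsilon>) =
      E n [0] (\<lambda>l. of_bool (norm (to_real_vec (hd l) /\<^sub>R real n - speed) > \<epsilon>))"
    by (rule annealed_prob_eq_path_mean)
  also have "\<dots> \<le> E n [0] (\<lambda>l. 1 / (\<epsilon> * real n)\<^sup>2 * (?Z l)\<^sup>2)"
  proof (rule mean_mono)
    fix l
    have "to_real_vec (hd l) /\<^sub>R real n - speed = (to_real_vec (hd l) - real n *\<^sub>R speed) /\<^sub>R real n"
      using assms by (simp add: scaleR_right_diff_distrib)
    then have eq: "norm (to_real_vec (hd l) /\<^sub>R real n - speed) = ?Z l / real n"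
      by (simp add: divide_inverse mult.commute)
    show "of_bool (norm (to_real_vec (hd l) /\<^sub>R real n - speed) > \<epsilon>) \<le> 1 / (\<epsilon> * real n)\<^sup>2 * (?Z l)\<^sup>2"
    proof (cases "norm (to_real_vec (hd l) /\<^sub>R real n - speed) > \<epsilon>")
      case True
      then have "\<epsilon> * real n \<le> ?Z l" unfolding eq using assms by (simp add: pos_less_divide_eq)
      then have "(\<epsilon> * real n)\<^sup>2 \<le> (?Z l)\<^sup>2" using assms by (intro power_mono) auto
      then show ?thesis using True assms by simp
    qed simp
  qed
  also have "\<dots> \<le> 1 / (\<epsilon> * real n)\<^sup>2 * (real n * ?B)"
    unfolding mean_cmult by (intro mult_left_mono mean_square_error) simp
  also have "\<dots> = ?B / (\<epsilon>\<^sup>2 * real n)"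
    using assms by (simp add: power2_eq_square field_simps)
  finally show ?thesis .
qed

lemma annealed_weak_law:
  assumes \<epsilon>: "0 < \<epsilon>"
  shows "(\<lambda>n. \<P>(\<omega> in annealed_law \<mu>. norm (to_real_vec (\<omega> n) /\<^sub>R real n - speed) > \<epsilon>)) \<longlonglongrightarrow> 0"
proof (rule tendsto_sandwich[OF _ _ tendsto_const])
  define C where "C = 12 * \<kappa> * green_constant \<delta> s (real CARD('b))"
  have C: "0 \<le> C"
    unfolding C_def using kappa_nonneg green_constant_pos[OF delta_pos, of "real CARD('b)" s]
    by (intro mult_nonneg_nonneg) auto
  let ?F = "\<lambda>n. (4 + C * (real n powr (1/2) * (2 * ln (real n))) * (1 + 2 * ln (real n))) / (\<epsilon>\<^sup>2 * real n)"
  show "?F \<longlonglongrightarrow> 0" using \<epsilon> by real_asymp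
  show "\<forall>\<^sub>F n in sequentially.
      \<P>(\<omega> in annealed_law \<mu>. norm (to_real_vec (\<omega> n) /\<^sub>R real n - speed) > \<epsilon>) \<le> ?F n"
    using eventually_ge_at_top[of 3]
  proof eventually_elim
    case (elim n)
    have "\<P>(\<omega> in annealed_law \<mu>. norm (to_real_vec (\<omega> n) /\<^sub>R real n - speed) > \<epsilon>) \<le>
        (4 + C * (real n powr (1 - s) * harm n) * (1 + harm n)) / (\<epsilon>\<^sup>2 * real n)"
      using deviation_prob_le[OF \<epsilon>, of n] elim by (simp add: C_def mult.assoc)
    also have "\<dots> \<le> ?F n"
      using C elim s \<epsilon> harm_le_2_ln[OF elim]
      by (intro divide_right_mono add_left_mono mult_mono mult_left_mono powr_mono)
        (auto intro!: mult_nonneg_nonneg harm_nonneg add_nonneg_nonneg)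
    finally show ?case .
  qed
qed (simp add: eventually_sequentially)

end

theorem theorem2p5:
  fixes \<delta> :: real
  assumes "CARD('b::finite) > 4" and "\<delta> > 0"
  shows "\<exists>\<beta>\<^sub>0>0. \<forall>\<beta>\<le>\<beta>\<^sub>0. \<forall>\<mu> :: (int ^ ('a::finite + 'b)) measure measure.
    partially_random \<delta> \<beta> \<mu> \<longrightarrow>
    (\<exists>\<theta> :: real ^ ('a + 'b).
      (\<lambda>n. norm ((\<integral>\<omega>. to_real_vec (\<omega> n) \<partial>annealed_law \<mu>) - real n *\<^sub>R \<theta>))
        \<in> O(\<lambda>n. real n * (ln (real n) / real n powr min 1 ((real CARD('b) - 4) / 2))) \<and>
      (\<forall>\<epsilon>>0. (\<lambda>n. \<P>(\<omega> in annealed_law \<mu>.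
        norm (to_real_vec (\<omega> n) /\<^sub>R real n - \<theta>) > \<epsilon>)) \<longlonglongrightarrow> 0))"
proof -
  \<comment> \<open>The heat kernel bound allows any \<open>s \<le> (d\<^sub>1 - 4) / 2\<close>, but beyond \<open>s = 1\<close> the sums over time do not improve.\<close>
  define s where "s = min 1 ((real CARD('b) - 4) / 2)"
  have s: "1/2 \<le> s" "s \<le> 1" "2 + s \<le> real CARD('b) / 2"
    using assms(1) by (auto simp: s_def min_def field_simps)
  define c where "c = 6 * real (card (unit_steps :: (int ^ ('a + 'b)) set)) * green_constant \<delta> s (real CARD('b))"
  have "card (unit_steps :: (int ^ ('a + 'b)) set) \<noteq> 0"
  proof -
    have "axis undefined 1 \<in> (unit_steps :: (int ^ ('a + 'b)) set)" by (auto simp: unit_steps_def)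
    then show ?thesis using finite_unit_steps by (auto simp: card_eq_0_iff)
  qed
  then have c: "0 < c"
    using green_constant_pos[OF assms(2), of "real CARD('b)" s] by (simp add: c_def)
  show ?thesis
  proof (intro exI[of _ "1 / c"] conjI allI impI)
    show "0 < 1 / c" using c by simp
    fix \<beta> :: real and \<mu> :: "(int ^ ('a + 'b)) measure measure"
    assume \<beta>: "\<beta> \<le> 1 / c" and \<mu>: "partially_random \<delta> \<beta> \<mu>"
    have "c * \<beta> \<le> 1" using \<beta> c by (simp add: pos_le_divide_eq mult.commute)
    interpret small_disorder_walk \<mu> \<delta> \<beta> s
      by unfold_locales (use \<mu> s \<open>c * \<beta> \<le> 1\<close> in \<open>simp_all add: c_def\<close>)
    show "\<exists>\<theta> :: real ^ ('a + 'b).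
        (\<lambda>n. norm ((\<integral>\<omega>. to_real_vec (\<omega> n) \<partial>annealed_law \<mu>) - real n *\<^sub>R \<theta>))
          \<in> O(\<lambda>n. real n * (ln (real n) / real n powr min 1 ((real CARD('b) - 4) / 2))) \<and>
        (\<forall>\<epsilon>>0. (\<lambda>n. \<P>(\<omega> in annealed_law \<mu>.
          norm (to_real_vec (\<omega> n) /\<^sub>R real n - \<theta>) > \<epsilon>)) \<longlonglongrightarrow> 0)"
      using annealed_mean_bigo annealed_weak_law unfolding s_def[symmetric] by blast
  qed
qed

end
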